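(* Let $G=(V,E)$ be a finite connected Eulerian directed multigraph and let $\alpha$ be a probability distribution on $V$ with $\alpha_j>0$ for all $j\in V$. For an initial sandpile $s_0:V\to\mathbb{Z}$ let $(s_k)_{k\ge0}$ be the closed chain started at $s_0$ and driven by the i.i.d. sequence $i_1,i_2,\ldots$ with law $\alpha$, and let $\tau=\min\{k\ge0: s_k\text{ is not stabilizable}\}$. Then for each $i\in V$ and each $\rho\in\mathrm{Rec}(i)$, as $|s_0|\to-\infty$, $$\mathbb{P}_{s_0}\{i_\tau=i,\ R_i(s_\tau)=\rho\}\;\to\;\frac{\alpha_i}{\kappa}.$$
   Context: Graph and Laplacian. $G=(V,E)$ is a finite directed graph, multiple edges permitted, connected and Eulerian: each vertex $i$ has the same number $\deg(i)$ of incoming edges as outgoing edges. For $u:V\to\mathbb{Z}$, $\Delta u(i)=-\deg(i)u(i)+\sum_e u(e^-)$, the sum being over edges $e$ coming into $i$, with $e^-$ the other endpoint (tail) of $e$. $\delta_i(j)=\mathbf{1}\{i=j\}$. Sandpiles. A sandpile is a function $s:V\to\mathbb{Z}$ (negative values allowed); $|s|=\sum_{i\in V}s(i)$. Vertex $i$ is unstable if $s(i)\ge\deg(i)$; toppling an unstable vertex $i$ replaces $s$ by $s+\Delta\delta_i$. $s$ is stabilizable if some finite (possibly empty) sequence of topplings of unstable vertices leads to a sandpile $\mathcal{S}(s)\le\deg-1$ (coordinatewise); $\mathcal{S}(s)$ does not depend on the sequence chosen. Closed chain. For $i\in V$, $a_i s=\mathcal{S}(s+\delta_i)$ if $s+\delta_i$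 is stabilizable, and $a_i s=s+\delta_i$ otherwise. Let $i_1,i_2,\ldots$ be independent random vertices with law $\alpha$. The closed chain started from a sandpile $s_0$ is $s_k=a_{i_k}s_{k-1}$ for $k\ge1$. $\mathbb{P}_{s_0}$ is the law of the process with initial state $s_0$. Recurrent sandpiles. For a vertex $z$ (the sink), $\mathcal{S}_z$ denotes stabilization in which $z$ is forbidden to topple: unstable vertices other than $z$ are toppled until no vertex of $V-\{z\}$ is unstable (this always terminates), and chips entering $z$ disappear. A sandpile $\rho$ is $z$-recurrent if $\rho(z)=\deg(z)$, $\rho(i)\le\deg(i)-1$ for all $i\ne z$, and every vertex of $V-\{z\}$ topples exactly once during the stabilization of $\rho+\Delta\delta_z$ with respect to $\mathcal{S}_z$. $\mathrm{Rec}(z)$ is the set of $z$-recurrent sandpiles; its cardinality $\kappa$ does not depend on $z$. Recurrent representative. For each $z\in V$, every sandpile $s$ can be written in exactly one way as $s=\rho+m\delta_z+\Delta v$ with $\rho\in\mathrm{Rec}(z)$, $m\in\mathbb{Z}$, $v:V\to\mathbb{Z}$ and $v(z)=0$; $R_z(s)$ denotes this $\rho$. Limit. "$F(s_0)\to L$ as $|s_0|\to-\infty$" means: for every $\epsilon>0$ there is $K<0$ such that $|F(s_0)-L|\le\epsilon$ for every $s_0:V\to\mathbb{Z}$ with $|s_0|<K$. *)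

theory Defs
  imports "HOL-Probability.Probability" "Graph_Theory.Digraph_Component"
begin

text \<open>
  The vertex set is a finite type: the definitions below are meant for a digraph \<open>G\<close> with
  \<open>verts G = UNIV\<close>, so that sandpiles are arbitrary functions \<open>'v \<Rightarrow> int\<close>.
  The arcs form a set with \<open>tail\<close> and \<open>head\<close> maps, so parallel arcs (and loops) are allowed.
\<close>

definition deg :: "('v, 'e) pre_digraph \<Rightarrow> 'v \<Rightarrow> int" where
  "deg G i = int (in_degree G i)"

definition laplacian :: "('v, 'e) pre_digraph \<Rightarrow> ('v \<Rightarrow> int) \<Rightarrow> 'v \<Rightarrow> int" where
  "laplacian G u i = - deg G i * u i + (\<Sum>e\<in>in_arcs G i. u (tail G e))"

definition delta :: "'v \<Rightarrow> 'v \<Rightarrow> int" where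
  "delta i j = (if i = j then 1 else 0)"

definition mass :: "('v::finite \<Rightarrow> int) \<Rightarrow> int" where
  "mass s = (\<Sum>i\<in>UNIV. s i)"

text \<open>
  \<open>toppling G Z s xs t\<close>: toppling the vertices of the list \<open>xs\<close> in order, each unstable at its
  turn and none in \<open>Z\<close>, leads from \<open>s\<close> to \<open>t\<close>. The vertices of \<open>Z\<close> are sinks: they never topple
  and chips sent to them disappear. \<open>Z = {}\<close> is ordinary toppling, \<open>Z = {z}\<close> toppling with sink \<open>z\<close>.
\<close>

inductive toppling ::
  "('v, 'e) pre_digraph \<Rightarrow> 'v set \<Rightarrow> ('v \<Rightarrow> int) \<Rightarrow> 'v list \<Rightarrow> ('v \<Rightarrow> int) \<Rightarrow> bool"
  for G :: "('v, 'e) pre_digraph" and Z :: "'v set"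
where
  Nil: "toppling G Z s [] s"
| Cons: "\<lbrakk>i \<notin> Z; s i \<ge> deg G i;
          toppling G Z (\<lambda>j. if j \<in> Z then s j else s j + laplacian G (delta i) j) xs t\<rbrakk>
         \<Longrightarrow> toppling G Z s (i # xs) t"

definition stabilizes ::
  "('v, 'e) pre_digraph \<Rightarrow> 'v set \<Rightarrow> ('v \<Rightarrow> int) \<Rightarrow> 'v list \<Rightarrow> ('v \<Rightarrow> int) \<Rightarrow> bool" where
  "stabilizes G Z s xs t \<longleftrightarrow> toppling G Z s xs t \<and> (\<forall>i. i \<notin> Z \<longrightarrow> t i \<le> deg G i - 1)"

definition stabilizable :: "('v, 'e) pre_digraph \<Rightarrow> ('v \<Rightarrow> int) \<Rightarrow> bool" where
  "stabilizable G s \<longleftrightarrow> (\<exists>xs t. stabilizes G {} s xs t)"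

text \<open>The final sandpile does not depend on the toppling sequence, so \<open>THE\<close> is well defined for
  stabilizable \<open>s\<close>.\<close>

definition stabilization :: "('v, 'e) pre_digraph \<Rightarrow> ('v \<Rightarrow> int) \<Rightarrow> 'v \<Rightarrow> int" where
  "stabilization G s = (THE t. \<exists>xs. stabilizes G {} s xs t)"

definition add_chip :: "('v, 'e) pre_digraph \<Rightarrow> 'v \<Rightarrow> ('v \<Rightarrow> int) \<Rightarrow> 'v \<Rightarrow> int" where
  "add_chip G i s =
     (let s' = (\<lambda>j. s j + delta i j)
      in if stabilizable G s' then stabilization G s' else s')"

text \<open>The driving sequence is \<open>x 1, x 2, \<dots>\<close>; the entry \<open>x 0\<close> is not used.\<close>

primrec closed_chain ::
  "('v, 'e) pre_digraph \<Rightarrow> (nat \<Rightarrow> 'v) \<Rightarrow> ('v \<Rightarrow> int) \<Rightarrow> nat \<Rightarrow> 'v \<Rightarrow> int" where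
  "closed_chain G x s0 0 = s0"
| "closed_chain G x s0 (Suc k) = add_chip G (x (Suc k)) (closed_chain G x s0 k)"

text \<open>Such a \<open>k\<close> always exists: while the chain stays stabilizable, its mass grows by \<open>1\<close> in each
  step, whereas the mass of a stable sandpile is bounded.\<close>

definition threshold_time :: "('v, 'e) pre_digraph \<Rightarrow> (nat \<Rightarrow> 'v) \<Rightarrow> ('v \<Rightarrow> int) \<Rightarrow> nat" where
  "threshold_time G x s0 = (LEAST k. \<not> stabilizable G (closed_chain G x s0 k))"

text \<open>With a sink, stabilization always terminates and the number of topplings of each vertex does
  not depend on the order, so the choice of the sequence \<open>xs\<close> is immaterial.\<close>

definition recurrent :: "('v, 'e) pre_digraph \<Rightarrow> 'v \<Rightarrow> ('v \<Rightarrow> int) \<Rightarrow> bool" where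
  "recurrent G z \<rho> \<longleftrightarrow>
     \<rho> z = deg G z \<and> (\<forall>i. i \<noteq> z \<longrightarrow> \<rho> i \<le> deg G i - 1) \<and>
     (\<exists>xs t. stabilizes G {z} (\<lambda>j. \<rho> j + laplacian G (delta z) j) xs t \<and>
             (\<forall>i. i \<noteq> z \<longrightarrow> count_list xs i = 1))"

definition Rec :: "('v, 'e) pre_digraph \<Rightarrow> 'v \<Rightarrow> ('v \<Rightarrow> int) set" where
  "Rec G z = {\<rho>. recurrent G z \<rho>}"

definition recurrent_rep :: "('v, 'e) pre_digraph \<Rightarrow> 'v \<Rightarrow> ('v \<Rightarrow> int) \<Rightarrow> 'v \<Rightarrow> int" where
  "recurrent_rep G z s =
     (THE \<rho>. \<rho> \<in> Rec G z \<and>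
        (\<exists>m v. v z = 0 \<and> s = (\<lambda>j. \<rho> j + m * delta z j + laplacian G v j)))"

end

theory Submission
  imports Defs
begin

text \<open>
  Call two sandpiles equivalent if they differ by \<open>laplacian G u\<close> for some integer function \<open>u\<close>.
  Constants are in the kernel of the Laplacian (in-degree and out-degree agree), so one may always
  take \<open>u \<ge> 0\<close>; by the least action principle a sandpile is therefore stabilizable iff it is equivalent
  to a stable one (\<open>stabilizable_iff\<close>). Thus stabilizability depends on the equivalence class
  only, and toppling moves inside a class: up to equivalence the closed chain is the random walk
  that adds the chips \<open>delta (x 1), delta (x 2), \<dots>\<close> to \<open>s0\<close>.

  If \<open>\<rho>\<close> is \<open>i\<close>-recurrent, then \<open>\<rho> + m * delta i\<close> is stabilizable iff \<open>m < 0\<close>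
  (\<open>recurrent_stabilizable_iff\<close>), and every sandpile is equivalent to exactly one such
  \<open>\<rho> + m * delta i\<close> (\<open>exists_recurrent\<close>, \<open>recurrent_unique\<close>). If the last added chip was at \<open>i\<close>,
  it raised \<open>m\<close> by one and crossed the threshold, so \<open>m = 0\<close> afterwards: the threshold state is
  equivalent to \<open>\<rho>\<close> itself. Hence the event in question says that the walk sits in the class of
  \<open>\<rho> - delta i\<close> and then receives a chip at \<open>i\<close>. As the mass grows by one per step, this can happen
  at one time only, namely after \<open>n = mass \<rho> - 1 - mass s0\<close> steps (\<open>threshold_event_iff\<close>). By
  independence the probability is \<open>pmf \<alpha> i\<close> times the probability that the \<open>n\<close>-step walk ends in the
  class of \<open>\<rho> - delta i\<close>.

  It remains to see that the walk equidistributes over the classes of given mass. The sandpiles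
  \<open>\<rho>' - mass \<rho>' * delta z\<close> with \<open>\<rho>' \<in> Rec G z\<close> represent the classes of mass zero, so translating
  the starting point by them gives hitting probabilities that sum to one (\<open>sum_Rec_hit\<close>). They
  differ by an exponentially small amount, because any two sandpiles of equal mass become
  equivalent after suitable additions of \<open>mass (deg G)\<close> chips each: two independent walks merge with a
  probability bounded away from zero (\<open>couple_by_chips\<close>, \<open>hit_oscillation\<close>). So each of them tends to
  \<open>1 / card (Rec G z)\<close>, uniformly in the starting point.
\<close>

section \<open>Mass, equivalence and forbidden sets\<close>

lemma mass_add: "mass (\<lambda>j. s j + t j) = mass s + mass t"
  by (simp add: mass_def sum.distrib)

lemma mass_delta: "mass (\<lambda>j. m * delta z j) = m"
  by (simp add: mass_def delta_def if_distrib[of "(*) m"] cong: if_cong)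

lemma mass_delta1: "mass (delta i) = 1"
  using mass_delta[of 1 i] by simp

lemma mass_diff: "mass (\<lambda>j. s j - t j) = mass s - mass t"
  by (simp add: mass_def sum_subtractf)

definition chips :: "(nat \<Rightarrow> 'v) \<Rightarrow> nat \<Rightarrow> 'v \<Rightarrow> int" where
  "chips x n j = (\<Sum>k=1..n. delta (x k) j)"

lemma mass_chips: "mass (chips x n) = int n"
  unfolding mass_def chips_def by (subst sum.swap) (simp add: mass_delta[of 1, unfolded mass_def, simplified])

lemma chips_mono: "k \<le> n \<Longrightarrow> chips x k j \<le> chips x n j"
  unfolding chips_def by (intro sum_mono2) (auto simp: delta_def)

text \<open>A set \<open>A\<close> avoiding the sink is forbidden for \<open>\<rho>\<close> if each \<open>i \<in> A\<close> has fewer chips than in-arcs from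
  \<open>A\<close>. If everything outside \<open>A\<close> topples once, such a set still cannot start to topple; Dhar's burning
  test says that the absence of forbidden sets is what makes the whole graph topple.\<close>

definition inner_degree :: "('v, 'e) pre_digraph \<Rightarrow> 'v set \<Rightarrow> 'v \<Rightarrow> int" where
  "inner_degree G A i = int (card {e \<in> in_arcs G i. tail G e \<in> A})"

definition no_forbidden_set :: "('v, 'e) pre_digraph \<Rightarrow> 'v \<Rightarrow> ('v \<Rightarrow> int) \<Rightarrow> bool" where
  "no_forbidden_set G z \<rho> \<longleftrightarrow> (\<forall>A. A \<noteq> {} \<longrightarrow> z \<notin> A \<longrightarrow> (\<exists>i\<in>A. inner_degree G A i \<le> \<rho> i))"

definition equivalent :: "('v, 'e) pre_digraph \<Rightarrow> ('v \<Rightarrow> int) \<Rightarrow> ('v \<Rightarrow> int) \<Rightarrow> bool" where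
  "equivalent G s t \<longleftrightarrow> (\<exists>u. t = (\<lambda>j. s j + laplacian G u j))"

section \<open>The Laplacian of a connected Eulerian digraph\<close>

locale eulerian_sandpile = fin_digraph G
  for G :: "('v::finite, 'e) pre_digraph" +
  assumes verts_UNIV: "verts G = UNIV"
    and connected_G: "Digraph_Component.connected G"
    and balanced: "in_degree G v = out_degree G v"
begin

lemma laplacian_eq: "laplacian G u i = (\<Sum>e\<in>in_arcs G i. u (tail G e) - u i)"
  by (simp add: laplacian_def sum_subtractf deg_def in_degree_def)

lemma laplacian_add: "laplacian G (\<lambda>j. u j + v j) i = laplacian G u i + laplacian G v i"
  and laplacian_minus: "laplacian G (\<lambda>j. - u j) i = - laplacian G u i"
  and laplacian_mult: "laplacian G (\<lambda>j. c * u j) i = c * laplacian G u i"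
  and laplacian_const: "laplacian G (\<lambda>j. c) i = 0"
  unfolding laplacian_eq
  by (simp_all add: sum.distrib[symmetric] sum_negf[symmetric] sum_distrib_left algebra_simps)

lemma laplacian_diff: "laplacian G (\<lambda>j. u j - v j) i = laplacian G u i - laplacian G v i"
  using laplacian_add[of u "\<lambda>j. - v j" i] by (simp add: laplacian_minus)

text \<open>This is where the Eulerian condition enters: \<open>u i\<close> is counted once per outgoing arc of \<open>i\<close> and
  subtracted once per incoming arc.\<close>

lemma mass_laplacian: "mass (laplacian G u) = 0"
proof -
  have "(\<Sum>i\<in>UNIV. \<Sum>e\<in>in_arcs G i. u (tail G e)) = (\<Sum>e\<in>arcs G. u (tail G e))"
    unfolding in_arcs_def by (rule sum.group) auto
  also have "\<dots> = (\<Sum>i\<in>UNIV. \<Sum>e\<in>out_arcs G i. u (tail G e))"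
    unfolding out_arcs_def by (rule sum.group[symmetric]) auto
  also have "\<dots> = (\<Sum>i\<in>UNIV. deg G i * u i)"
    by (rule sum.cong) (simp_all add: deg_def balanced out_degree_def)
  finally show ?thesis
    by (simp add: mass_def laplacian_def sum_subtractf)
qed

text \<open>Strong connectivity. The indicator \<open>u\<close> of a set closed under outgoing arcs has a nonpositive
  Laplacian whose sum vanishes in an Eulerian digraph. So no arc enters the set from outside either,
  and weak connectivity applies.\<close>

lemma arc_closed_UNIV:
  assumes "z \<in> T" and closed: "\<And>e. e \<in> arcs G \<Longrightarrow> tail G e \<in> T \<Longrightarrow> head G e \<in> T"
  shows "T = UNIV"
proof -
  define u :: "'v \<Rightarrow> int" where "u = (\<lambda>j. if j \<in> T then 1 else 0)"
  have nonpos: "u (tail G e) - u i \<le> 0" if "e \<in> in_arcs G i" for e i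
    using that closed[of e] by (auto simp: u_def)
  then have le: "laplacian G u i \<le> 0" for i
    unfolding laplacian_eq by (intro sum_nonpos)
  have "(\<Sum>i\<in>UNIV. - laplacian G u i) = 0"
    using mass_laplacian[of u] by (simp add: mass_def sum_negf)
  then have "laplacian G u i = 0" for i
    using le by (subst (asm) sum_nonneg_eq_0_iff) auto
  then have "(\<Sum>e\<in>in_arcs G i. - (u (tail G e) - u i)) = 0" for i
    unfolding laplacian_eq sum_negf by simp
  then have zero: "- (u (tail G e) - u i) = 0" if "e \<in> in_arcs G i" for e i
    using that nonpos by (subst (asm) sum_nonneg_eq_0_iff) (auto simp: finite_in_arcs)
  have both: "tail G e \<in> T \<longleftrightarrow> head G e \<in> T" if "e \<in> arcs G" for e
    using zero[of e "head G e"] that by (auto simp: u_def split: if_splits)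
  have "v \<in> T" for v
  proof -
    have "z \<rightarrow>\<^sup>*\<^bsub>with_proj (mk_symmetric G)\<^esub> v"
      using connected_G verts_UNIV
      by (auto simp: Digraph_Component.connected_def strongly_connected_def)
    then have "(z, v) \<in> rtrancl_on UNIV (parcs (mk_symmetric G))"
      by (simp add: reachable_def verts_UNIV)
    then show ?thesis
      using \<open>z \<in> T\<close>
      by (induction rule: rtrancl_on.induct) (use both in \<open>auto simp: parcs_mk_symmetric\<close>)
  qed
  then show ?thesis by auto
qed

lemma exists_rank:
  obtains r :: "'v \<Rightarrow> nat"
  where "\<forall>i. i \<noteq> z \<longrightarrow> (\<exists>e\<in>in_arcs G i. r (tail G e) < r i)"
proof -
  define R where "R = {(tail G e, head G e) | e. e \<in> arcs G}"
  have "{v. (z, v) \<in> R\<^sup>*} = UNIV"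
    by (rule arc_closed_UNIV) (auto simp: R_def intro: rtrancl_into_rtrancl)
  then have reach: "\<exists>n. (z, v) \<in> R ^^ n" for v
    using rtrancl_imp_relpow by blast
  define r where "r v = (LEAST n. (z, v) \<in> R ^^ n)" for v
  have "\<exists>e\<in>in_arcs G i. r (tail G e) < r i" if "i \<noteq> z" for i
  proof -
    have ri: "(z, i) \<in> R ^^ r i"
      unfolding r_def by (rule LeastI_ex[OF reach])
    with that obtain n where n: "r i = Suc n" by (cases "r i") auto
    with ri obtain e where e: "e \<in> in_arcs G i" "(z, tail G e) \<in> R ^^ n"
      by (auto simp: R_def)
    from e(2) have "r (tail G e) \<le> n" unfolding r_def by (rule Least_le)
    with e(1) n show ?thesis by (intro bexI[of _ e]) simp_all
  qed
  then show thesis by (intro that[of r]) blast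
qed

text \<open>The function is \<open>- B ^ (n - r)\<close>, where \<open>r\<close> is the distance from \<open>z\<close> and \<open>n\<close> its maximum. It is so
  concave in \<open>r\<close> that a single in-arc from a vertex closer to \<open>z\<close> outweighs all other in-arcs.
  Adding a multiple of this function reduces all vertices other than \<open>z\<close> at once, and it also
  serves as a barrier in a minimum principle.\<close>

lemma exists_superharmonic:
  obtains h where "h z = 0" and "\<forall>i. i \<noteq> z \<longrightarrow> laplacian G h i \<le> - 1"
proof -
  obtain r :: "'v \<Rightarrow> nat" where "\<forall>i. i \<noteq> z \<longrightarrow> (\<exists>e\<in>in_arcs G i. r (tail G e) < r i)"
    by (rule exists_rank[of z])
  then have r: "\<And>i. i \<noteq> z \<Longrightarrow> \<exists>e\<in>in_arcs G i. r (tail G e) < r i" by blast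
  define n where "n = Max (range r)"
  have rn: "r i \<le> n" for i by (simp add: n_def)
  define B :: int where "B = 1 + int (card (arcs G))"
  have B1: "1 \<le> B" by (simp add: B_def)
  define f where "f i = - (B ^ (n - r i))" for i
  have "laplacian G f i \<le> - 1" if "i \<noteq> z" for i
  proof -
    obtain e0 where e0: "e0 \<in> in_arcs G i" "r (tail G e0) < r i" using r[OF \<open>i \<noteq> z\<close>] by blast
    define p where "p = B ^ (n - r i)"
    have p1: "1 \<le> p" using B1 by (simp add: p_def one_le_power)
    \<comment> \<open>The in-arc \<open>e0\<close> comes from a vertex of smaller rank and contributes at most \<open>p - B * p\<close>.\<close>
    have "B * p = B ^ Suc (n - r i)" by (simp add: p_def)
    also have "\<dots> \<le> B ^ (n - r (tail G e0))"
      using e0(2) rn[of i] B1 by (intro power_increasing) auto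
    finally have big: "f (tail G e0) - f i \<le> p - B * p" by (simp add: f_def p_def)
    have small: "f (tail G e) - f i \<le> p - 1" for e
      using B1 by (simp add: f_def p_def one_le_power)
    have "laplacian G f i
        = (f (tail G e0) - f i) + (\<Sum>e\<in>in_arcs G i - {e0}. f (tail G e) - f i)"
      unfolding laplacian_eq using e0(1) by (subst sum.remove) (auto simp: finite_in_arcs)
    also have "\<dots> \<le> (p - B * p) + (\<Sum>e\<in>in_arcs G i - {e0}. p - 1)"
      using big small by (intro add_mono sum_mono) auto
    also have "\<dots> = (p - B * p) + int (card (in_arcs G i - {e0})) * (p - 1)" by simp
    also have "\<dots> \<le> (p - B * p) + (B - 1) * (p - 1)"
    proof -
      have "card (in_arcs G i - {e0}) \<le> card (arcs G)"
        by (intro card_mono) auto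
      then show ?thesis using p1 by (intro add_left_mono mult_right_mono) (auto simp: B_def)
    qed
    also have "\<dots> = 1 - B" by (simp add: algebra_simps)
    also have "\<dots> \<le> - 1"
    proof -
      have "arcs G \<noteq> {}" using e0(1) by auto
      then have "0 < card (arcs G)" by (simp add: card_gt_0_iff)
      then show ?thesis by (simp add: B_def)
    qed
    finally show ?thesis .
  qed
  then show thesis
    by (intro that[of "\<lambda>j. f j - f z"]) (auto simp: laplacian_diff laplacian_const)
qed

section \<open>Toppling and stabilizability\<close>

lemma toppling_result:
  assumes "toppling G Z s xs t" "j \<notin> Z"
  shows "t j = s j + laplacian G (\<lambda>k. int (count_list xs k)) j"
  using assms
proof (induction rule: toppling.induct)
  case (Nil s)
  then show ?case by (simp add: laplacian_const)
next
  case (Cons i s xs t)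
  have "(\<lambda>k. int (count_list (i # xs) k)) = (\<lambda>k. delta i k + int (count_list xs k))"
    by (auto simp: delta_def)
  with Cons show ?case by (simp only: laplacian_add) simp
qed

lemma toppling_avoids: "toppling G Z s xs t \<Longrightarrow> set xs \<inter> Z = {}"
  by (induction rule: toppling.induct) auto

lemma toppling_appendD:
  "toppling G Z s (ys @ zs) t \<Longrightarrow> \<exists>r. toppling G Z s ys r \<and> toppling G Z r zs t"
proof (induction ys arbitrary: s)
  case Nil
  then show ?case by (auto intro: toppling.Nil)
next
  case (Cons i ys)
  from Cons.prems have i: "i \<notin> Z" "deg G i \<le> s i" and
    rest: "toppling G Z (\<lambda>j. if j \<in> Z then s j else s j + laplacian G (delta i) j) (ys @ zs) t"
    by (auto elim: toppling.cases)
  from Cons.IH[OF rest] i show ?case by (auto intro: toppling.Cons)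
qed

lemma stable_not_at_zero:
  assumes "\<And>j. 0 \<le> u j" "deg G i \<le> s i" "s i + laplacian G u i \<le> deg G i - 1"
  shows "1 \<le> u i"
proof (rule ccontr)
  assume "\<not> 1 \<le> u i"
  with assms(1)[of i] have "u i = 0" by simp
  then have "0 \<le> laplacian G u i" unfolding laplacian_eq using assms(1) by (auto intro: sum_nonneg)
  with assms(2,3) show False by simp
qed

text \<open>Least action principle: a legal toppling sequence cannot topple \<open>j\<close> more often than any
  nonnegative function that stabilizes. A vertex that has used up its share \<open>u j\<close> would have to be
  stable by now, since the other vertices can only send it more chips.\<close>

lemma toppling_least_action:
  assumes "toppling G {} s xs t" "\<And>j. 0 \<le> u j" "\<And>j. s j + laplacian G u j \<le> deg G j - 1"
  shows "int (count_list xs j) \<le> u j"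
  using assms
proof (induction arbitrary: u rule: toppling.induct)
  case (Nil s)
  then show ?case by simp
next
  case (Cons i s xs t)
  have "1 \<le> u i" using Cons.prems Cons.hyps by (intro stable_not_at_zero[of u i s]) auto
  with Cons.prems have "0 \<le> u j - delta i j" for j by (auto simp: delta_def)
  moreover have "(if j \<in> {} then s j else s j + laplacian G (delta i) j)
      + laplacian G (\<lambda>a. u a - delta i a) j \<le> deg G j - 1" for j
    using Cons.prems(2)[of j] by (simp add: laplacian_diff)
  ultimately have "int (count_list xs j) \<le> u j - delta i j" by (rule Cons.IH)
  then show ?case by (auto simp: delta_def)
qed

text \<open>Legality is automatic: after a shift \<open>u\<close> is nonnegative, and as long as some vertex \<open>i\<close> is unstable,
  \<open>u i \<ge> 1\<close>, so toppling \<open>i\<close> uses up one unit of \<open>u\<close>.\<close>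

lemma stabilizable_iff:
  "stabilizable G s \<longleftrightarrow> (\<exists>u. \<forall>j. s j + laplacian G u j \<le> deg G j - 1)"
proof
  assume "stabilizable G s"
  then obtain xs t where "toppling G {} s xs t" "\<forall>j. t j \<le> deg G j - 1"
    by (auto simp: stabilizable_def stabilizes_def)
  then show "\<exists>u. \<forall>j. s j + laplacian G u j \<le> deg G j - 1"
    using toppling_result[of "{}" s xs t] by (metis empty_iff)
next
  have ind: "\<exists>xs t. stabilizes G {} s xs t"
    if "mass u = int n" "\<And>j. 0 \<le> u j" "\<And>j. s j + laplacian G u j \<le> deg G j - 1" for n u s
    using that
  proof (induction n arbitrary: u s rule: less_induct)
    case (less n)
    show ?case
    proof (cases "\<forall>j. s j \<le> deg G j - 1")
      case True
      then show ?thesis by (auto simp: stabilizes_def intro: toppling.Nil)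
    next
      case False
      then obtain i where "\<not> s i \<le> deg G i - 1" by auto
      then have i: "deg G i \<le> s i" by simp
      let ?s = "\<lambda>j. s j + laplacian G (delta i) j" and ?u = "\<lambda>j. u j + (- 1) * delta i j"
      have u1: "1 \<le> u i" using less.prems i by (intro stable_not_at_zero[of u i s]) auto
      have m: "mass ?u = int n - 1"
        using less.prems(1) by (simp only: mass_add mass_delta)
      have u0: "0 \<le> ?u j" for j using less.prems(2)[of j] u1 by (auto simp: delta_def)
      then have "0 \<le> mass ?u" unfolding mass_def by (intro sum_nonneg) auto
      with m have "\<exists>xs t. stabilizes G {} ?s xs t"
        using u0 less.prems(3)
        by (intro less.IH[of "n - 1" ?u]) (auto simp: laplacian_diff)
      then obtain xs t where "toppling G {} ?s xs t" "\<forall>j. t j \<le> deg G j - 1"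
        by (auto simp: stabilizes_def)
      with i have "stabilizes G {} s (i # xs) t"
        by (auto simp: stabilizes_def intro!: toppling.Cons)
      then show ?thesis by blast
    qed
  qed
  assume "\<exists>u. \<forall>j. s j + laplacian G u j \<le> deg G j - 1"
  then obtain u where u: "\<And>j. s j + laplacian G u j \<le> deg G j - 1" by auto
  define v where "v j = u j - Min (range u)" for j
  have v0: "0 \<le> v j" for j by (simp add: v_def)
  then have "mass v = int (nat (mass v))" by (simp add: mass_def sum_nonneg)
  moreover have "s j + laplacian G v j \<le> deg G j - 1" for j
    using u[of j] by (simp add: v_def[abs_def] laplacian_diff laplacian_const)
  ultimately show "stabilizable G s"
    unfolding stabilizable_def by (intro ind[of v "nat (mass v)" s] v0)
qed

lemma stabilizes_unique:
  assumes "stabilizes G {} s xs t" "stabilizes G {} s xs' t'"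
  shows "t = t'"
proof -
  have *: "count_list xs j \<le> count_list xs' j" if "stabilizes G {} s xs t" "stabilizes G {} s xs' t'"
    for xs t xs' t' j
  proof -
    have "int (count_list xs j) \<le> int (count_list xs' j)"
    proof (rule toppling_least_action)
      show "toppling G {} s xs t" using that(1) by (simp add: stabilizes_def)
      show "s j + laplacian G (\<lambda>a. int (count_list xs' a)) j \<le> deg G j - 1" for j
        using that(2) toppling_result[of "{}" s xs' t' j] by (metis stabilizes_def empty_iff)
    qed simp
    then show ?thesis by simp
  qed
  have "count_list xs = count_list xs'"
    using *[OF assms] *[OF assms(2,1)] by (intro ext antisym)
  then show ?thesis
    using assms by (auto simp: stabilizes_def toppling_result[of "{}"])
qed

lemma equivalent_stabilization:
  assumes "stabilizable G s"
  shows "equivalent G s (stabilization G s)"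
proof -
  obtain xs t where st: "stabilizes G {} s xs t" using assms by (auto simp: stabilizable_def)
  then have "stabilization G s = t"
    unfolding stabilization_def by (intro the_equality) (auto dest: stabilizes_unique)
  moreover have "t = (\<lambda>j. s j + laplacian G (\<lambda>k. int (count_list xs k)) j)"
    using st by (auto simp: stabilizes_def toppling_result)
  ultimately show ?thesis by (auto simp: equivalent_def)
qed

lemma equivalent_refl: "equivalent G s s"
  unfolding equivalent_def by (rule exI[of _ "\<lambda>_. 0"]) (simp add: laplacian_const)

lemma equivalent_sym: "equivalent G s t \<Longrightarrow> equivalent G t s"
  unfolding equivalent_def
  by (elim exE, rule_tac x="\<lambda>j. - u j" in exI) (simp add: laplacian_minus)

lemma equivalent_trans: "equivalent G s t \<Longrightarrow> equivalent G t r \<Longrightarrow> equivalent G s r"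
  unfolding equivalent_def
  by (elim exE, rule_tac x="\<lambda>j. u j + ua j" in exI) (simp add: laplacian_add add.assoc)

lemma equivalent_add: "equivalent G s t \<Longrightarrow> equivalent G (\<lambda>j. s j + r j) (\<lambda>j. t j + r j)"
  unfolding equivalent_def by (elim exE, rule_tac x=u in exI) (simp add: algebra_simps)

lemma equivalent_mass: "equivalent G s t \<Longrightarrow> mass t = mass s"
  by (auto simp: equivalent_def mass_add mass_laplacian)

lemma equivalent_stabilizable:
  assumes "equivalent G s t" "stabilizable G t"
  shows "stabilizable G s"
proof -
  from assms obtain u v where "t = (\<lambda>j. s j + laplacian G u j)"
    "\<forall>j. t j + laplacian G v j \<le> deg G j - 1"
    by (auto simp: equivalent_def stabilizable_iff)
  then show ?thesis
    unfolding stabilizable_iff by (intro exI[of _ "\<lambda>j. u j + v j"]) (simp add: laplacian_add add.assoc)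
qed

section \<open>Recurrent sandpiles\<close>

lemma deg_split: "deg G i = inner_degree G A i + inner_degree G (- A) i"
proof -
  have "card ({e \<in> in_arcs G i. tail G e \<in> A} \<union> {e \<in> in_arcs G i. tail G e \<in> - A}) =
    card {e \<in> in_arcs G i. tail G e \<in> A} + card {e \<in> in_arcs G i. tail G e \<in> - A}"
    by (rule card_Un_disjoint) auto
  moreover have "{e \<in> in_arcs G i. tail G e \<in> A} \<union> {e \<in> in_arcs G i. tail G e \<in> - A}
    = in_arcs G i" by auto
  ultimately show ?thesis by (simp add: deg_def in_degree_def inner_degree_def)
qed

text \<open>The effect of toppling every vertex outside \<open>A\<close> once.\<close>

lemma laplacian_indicator:
  "laplacian G (\<lambda>k. if k \<in> A then 0 else 1) i =
     (if i \<in> A then deg G i - inner_degree G A i else - inner_degree G A i)"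
proof (cases "i \<in> A")
  case True
  have "laplacian G (\<lambda>k. if k \<in> A then 0 else 1) i = (\<Sum>e\<in>in_arcs G i. if tail G e \<in> - A then 1 else 0)"
    unfolding laplacian_eq using True by (intro sum.cong) auto
  also have "\<dots> = inner_degree G (- A) i"
    by (simp add: inner_degree_def sum.If_cases finite_in_arcs Int_def)
  finally show ?thesis using True deg_split[of i A] by simp
next
  case False
  have "laplacian G (\<lambda>k. if k \<in> A then 0 else 1) i = (\<Sum>e\<in>in_arcs G i. - (if tail G e \<in> A then 1 else 0))"
    unfolding laplacian_eq using False by (intro sum.cong) auto
  also have "\<dots> = - inner_degree G A i"
    unfolding sum_negf by (simp add: inner_degree_def sum.If_cases finite_in_arcs Int_def)
  finally show ?thesis using False by simp
qed

lemma laplacian_mono_at: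
  assumes "\<And>j. w j \<le> w' j" "w i = w' i"
  shows "laplacian G w i \<le> laplacian G w' i"
  unfolding laplacian_eq using assms by (intro sum_mono) auto

text \<open>Consider the first vertex of \<open>A\<close> to topple. So far only vertices outside \<open>A\<close> have toppled, each at
  most once, so what it received is at most its number of in-arcs from outside \<open>A\<close>.\<close>

lemma recurrent_no_forbidden_set:
  assumes "recurrent G z \<rho>"
  shows "no_forbidden_set G z \<rho>"
  unfolding no_forbidden_set_def
proof (intro allI impI)
  fix A :: "'v set" assume A: "A \<noteq> {}" "z \<notin> A"
  obtain xs t where xs: "toppling G {z} (\<lambda>j. \<rho> j + laplacian G (delta z) j) xs t"
    and once: "\<And>i. i \<noteq> z \<Longrightarrow> count_list xs i = 1"
    using assms by (auto simp: recurrent_def stabilizes_def)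
  have "\<exists>i\<in>set xs. i \<in> A"
    using A once by (metis all_not_in_conv count_notin zero_neq_one)
  then obtain ys i zs where split: "xs = ys @ i # zs" "i \<in> A" "\<forall>k\<in>set ys. k \<notin> A"
    using split_list_first_prop[of xs "\<lambda>i. i \<in> A"] by blast
  have iz: "i \<noteq> z" using A split by auto
  have z: "z \<notin> set xs" using toppling_avoids[OF xs] by auto
  from xs split(1) obtain r where r: "toppling G {z} (\<lambda>j. \<rho> j + laplacian G (delta z) j) ys r"
    and "toppling G {z} r (i # zs) t" using toppling_appendD by blast
  then have "deg G i \<le> r i" by (auto elim: toppling.cases)
  also have "r i = \<rho> i + laplacian G (\<lambda>k. delta z k + int (count_list ys k)) i"
    using toppling_result[OF r, of i] iz by (simp add: laplacian_add)
  also have "laplacian G (\<lambda>k. delta z k + int (count_list ys k)) i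
      \<le> laplacian G (\<lambda>k. if k \<in> A then 0 else 1) i"
  proof (rule laplacian_mono_at)
    have "count_list ys k \<le> 1" if "k \<noteq> z" for k
      using once[OF that] split(1) by simp
    moreover have "count_list ys k = 0" if "k \<in> A" for k
      using that split by (auto simp: count_list_0_iff)
    moreover have "count_list ys z = 0" using z split by (auto simp: count_list_0_iff)
    ultimately show "delta z k + int (count_list ys k) \<le> (if k \<in> A then 0 else 1)" for k
      using A by (auto simp: delta_def)
    show "delta z i + int (count_list ys i) = (if i \<in> A then 0 else 1)"
      using \<open>\<And>k. k \<in> A \<Longrightarrow> count_list ys k = 0\<close> split iz by (auto simp: delta_def)
  qed
  finally show "\<exists>i\<in>A. inner_degree G A i \<le> \<rho> i"
    using split(2) by (intro bexI[of _ i]) (simp_all add: laplacian_indicator)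
qed

text \<open>Conversely, if all vertices outside \<open>A\<close> have toppled once, then the vertex supplied by the absence of
  forbidden sets can topple; now continue with the rest of \<open>A\<close>.\<close>

lemma burning:
  assumes "no_forbidden_set G z \<rho>" "z \<notin> A"
    and "\<And>j. j \<noteq> z \<Longrightarrow> s j = \<rho> j + laplacian G (\<lambda>k. if k \<in> A then 0 else 1) j"
  shows "\<exists>xs t. toppling G {z} s xs t \<and> (\<forall>i. count_list xs i = (if i \<in> A then 1 else 0))"
proof -
  have "finite A" by simp
  then show ?thesis using assms(2,3)
  proof (induction "card A" arbitrary: A s)
    case 0
    then show ?case by (intro exI[of _ "[]"]) (auto intro: toppling.Nil)
  next
    case (Suc n)
    then have "A \<noteq> {}" by auto
    with Suc.prems assms(1) obtain i where i: "i \<in> A" "inner_degree G A i \<le> \<rho> i"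
      by (auto simp: no_forbidden_set_def)
    have iz: "i \<noteq> z" using i Suc.prems by auto
    let ?s = "\<lambda>j. if j \<in> {z} then s j else s j + laplacian G (delta i) j"
    have unstable: "deg G i \<le> s i" using Suc.prems(3)[OF iz] i by (simp add: laplacian_indicator)
    have "\<exists>xs t. toppling G {z} ?s xs t \<and>
        (\<forall>k. count_list xs k = (if k \<in> A - {i} then 1 else 0))"
    proof (rule Suc.hyps(1))
      show "n = card (A - {i})" using Suc.hyps(2) i by simp
      show "z \<notin> A - {i}" using Suc.prems by auto
      fix j assume j: "j \<noteq> z"
      have "(\<lambda>k. if k \<in> A - {i} then 0 else 1) = (\<lambda>k. (if k \<in> A then 0 else 1) + delta i k)"
        using i by (auto simp: delta_def)
      then show "?s j = \<rho> j + laplacian G (\<lambda>k. if k \<in> A - {i} then 0 else 1) j"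
        using j Suc.prems(3)[OF j] by (simp only: laplacian_add) simp
    qed simp
    then obtain xs t where "toppling G {z} ?s xs t"
      "\<And>k. count_list xs k = (if k \<in> A - {i} then 1 else 0)" by auto
    with i iz unstable show ?case
      by (intro exI[of _ "i # xs"] exI[of _ t] conjI) (auto intro: toppling.Cons)
  qed
qed

lemma recurrent_iff:
  "recurrent G z \<rho> \<longleftrightarrow>
     \<rho> z = deg G z \<and> (\<forall>i. i \<noteq> z \<longrightarrow> \<rho> i \<le> deg G i - 1) \<and> no_forbidden_set G z \<rho>"
proof
  assume "recurrent G z \<rho>"
  then show "\<rho> z = deg G z \<and> (\<forall>i. i \<noteq> z \<longrightarrow> \<rho> i \<le> deg G i - 1) \<and> no_forbidden_set G z \<rho>"
    using recurrent_no_forbidden_set by (auto simp: recurrent_def)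
next
  assume R: "\<rho> z = deg G z \<and> (\<forall>i. i \<noteq> z \<longrightarrow> \<rho> i \<le> deg G i - 1) \<and> no_forbidden_set G z \<rho>"
  let ?s = "\<lambda>j. \<rho> j + laplacian G (delta z) j"
  have dz: "(\<lambda>k. if k \<in> - {z} then 0 else 1) = delta z" by (auto simp: delta_def)
  have "\<exists>xs t. toppling G {z} ?s xs t \<and> (\<forall>i. count_list xs i = (if i \<in> - {z} then 1 else 0))"
  proof (rule burning)
    show "no_forbidden_set G z \<rho>" using R by simp
    show "z \<notin> - {z}" by simp
  qed (simp only: dz)
  then obtain xs t where xs: "toppling G {z} ?s xs t"
    "\<And>i. count_list xs i = (if i \<in> - {z} then 1 else 0)" by auto
  have "t j \<le> deg G j - 1" if "j \<noteq> z" for j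
  proof -
    have "t j = \<rho> j + laplacian G (\<lambda>k. delta z k + int (count_list xs k)) j"
      using toppling_result[OF xs(1), of j] that by (simp add: laplacian_add)
    also have "(\<lambda>k. delta z k + int (count_list xs k)) = (\<lambda>_. 1)"
      by (auto simp: xs(2) delta_def)
    finally show ?thesis using R that by (simp add: laplacian_const)
  qed
  with xs R show "recurrent G z \<rho>"
    unfolding recurrent_def stabilizes_def by (auto intro!: exI[of _ xs] exI[of _ t])
qed

text \<open>The key property of recurrent sandpiles. The set \<open>A\<close> where \<open>u\<close> is minimal does not contain \<open>z\<close>.
  At \<open>i \<in> A\<close> each in-arc from outside \<open>A\<close> contributes at least one to the Laplacian of \<open>u\<close>, which
  together with the chips provided by the burning condition reaches \<open>deg G i\<close>.\<close>

lemma no_forbidden_set_min: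
  assumes "no_forbidden_set G z \<rho>" "\<exists>j. u j < u z"
  shows "\<exists>i. i \<noteq> z \<and> deg G i \<le> \<rho> i + laplacian G u i"
proof -
  define c where "c = Min (range u)"
  define A where "A = {i. u i = c}"
  have c: "c \<le> u j" for j by (simp add: c_def)
  have "c \<in> range u" unfolding c_def by (rule Min_in) auto
  then have "A \<noteq> {}" by (auto simp: A_def)
  moreover have zA: "z \<notin> A" using assms(2) c by (auto simp: A_def not_less) (metis not_le)
  ultimately obtain i where i: "i \<in> A" "inner_degree G A i \<le> \<rho> i"
    using assms(1) by (auto simp: no_forbidden_set_def)
  have "laplacian G (\<lambda>k. (if k \<in> A then 0 else 1)) i \<le> laplacian G (\<lambda>k. u k - c) i"
  proof (rule laplacian_mono_at)
    show "(if k \<in> A then 0 else 1) \<le> u k - c" for k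
      using c[of k] by (auto simp: A_def)
  qed (use i in \<open>auto simp: A_def\<close>)
  with i zA show ?thesis
    by (intro exI[of _ i]) (auto simp: laplacian_indicator laplacian_diff laplacian_const)
qed

lemma laplacian_at_min:
  assumes "\<And>j. u z \<le> u j" shows "0 \<le> laplacian G u z"
  unfolding laplacian_eq using assms by (intro sum_nonneg) auto

text \<open>If \<open>m \<ge> 0\<close> and \<open>u\<close> were to stabilize, then some vertex would stay unstable: \<open>z\<close> itself if \<open>u\<close> is minimal
  there, and otherwise the vertex from \<open>no_forbidden_set_min\<close>.\<close>

lemma recurrent_stabilizable_iff:
  assumes "recurrent G z \<rho>"
  shows "stabilizable G (\<lambda>j. \<rho> j + m * delta z j) \<longleftrightarrow> m < 0"
proof
  assume "m < 0"
  with assms have "\<rho> j + m * delta z j + laplacian G (\<lambda>_. 0) j \<le> deg G j - 1" for j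
    by (auto simp: recurrent_iff delta_def laplacian_const)
  then show "stabilizable G (\<lambda>j. \<rho> j + m * delta z j)"
    unfolding stabilizable_iff by blast
next
  assume "stabilizable G (\<lambda>j. \<rho> j + m * delta z j)"
  then obtain u where u: "\<And>j. \<rho> j + m * delta z j + laplacian G u j \<le> deg G j - 1"
    by (auto simp: stabilizable_iff)
  have "\<not> (\<exists>j. u j < u z)"
  proof
    assume "\<exists>j. u j < u z"
    then obtain i where "i \<noteq> z" "deg G i \<le> \<rho> i + laplacian G u i"
      using no_forbidden_set_min assms by (meson recurrent_iff)
    then show False using u[of i] by (simp add: delta_def)
  qed
  then have "0 \<le> laplacian G u z" by (intro laplacian_at_min) (auto simp: not_less)
  then show "m < 0" using u[of z] assms by (simp add: delta_def recurrent_iff)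
qed

text \<open>Let \<open>u\<close> realise the equivalence. If \<open>u\<close> were not minimal at \<open>z\<close>, then \<open>\<rho>'\<close> would be unstable
  somewhere off \<open>z\<close>; symmetrically \<open>- u\<close> is minimal at \<open>z\<close>, because \<open>\<rho>\<close> is stable off \<open>z\<close>. So \<open>u\<close> is
  constant.\<close>

lemma recurrent_unique:
  assumes "recurrent G z \<rho>" "recurrent G z \<rho>'"
    and "equivalent G (\<lambda>j. \<rho> j + m * delta z j) (\<lambda>j. \<rho>' j + m' * delta z j)"
  shows "\<rho> = \<rho>'"
proof -
  obtain u where u: "\<And>j. \<rho>' j + m' * delta z j = \<rho> j + m * delta z j + laplacian G u j"
    using assms(3) by (auto simp: equivalent_def fun_eq_iff)
  have off: "\<rho>' j = \<rho> j + laplacian G u j" if "j \<noteq> z" for j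
    using u[of j] that by (simp add: delta_def)
  have "\<not> (\<exists>j. u j < u z)"
  proof
    assume "\<exists>j. u j < u z"
    then obtain i where "i \<noteq> z" "deg G i \<le> \<rho> i + laplacian G u i"
      using no_forbidden_set_min assms by (meson recurrent_iff)
    then show False using off[of i] assms(2) by (auto simp: recurrent_iff)
  qed
  moreover have "\<not> (\<exists>j. - u j < - u z)"
  proof
    assume "\<exists>j. - u j < - u z"
    then obtain i where "i \<noteq> z" "deg G i \<le> \<rho>' i + laplacian G (\<lambda>j. - u j) i"
      using no_forbidden_set_min[of z \<rho>' "\<lambda>j. - u j"] assms by (meson recurrent_iff)
    then show False using off[of i] assms(1) by (auto simp: recurrent_iff laplacian_minus)
  qed
  ultimately have "u = (\<lambda>_. u z)" by (auto simp: not_less intro: antisym)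
  then have "laplacian G u j = 0" for j by (metis laplacian_const)
  then show ?thesis using off assms(1,2) by (auto simp: recurrent_iff fun_eq_iff) (metis add_0_right)
qed

text \<open>Among all \<open>v\<close> with \<open>v z = 0\<close> for which \<open>s + laplacian G v\<close> is stable off \<open>z\<close>, take one of least
  total. A forbidden set \<open>A\<close> would be exactly one on which \<open>v\<close> can be lowered by one without losing
  stability off \<open>z\<close>, so there is none. The superharmonic function \<open>h\<close> shows both that such \<open>v\<close> exist and
  that they are bounded below.\<close>

lemma exists_recurrent:
  obtains \<rho> m where "recurrent G z \<rho>" "equivalent G (\<lambda>j. \<rho> j + m * delta z j) s"
proof -
  obtain h where h: "h z = 0" "\<forall>i. i \<noteq> z \<longrightarrow> laplacian G h i \<le> - 1"
    by (rule exists_superharmonic[of z])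
  define C where "C = Max (range (\<lambda>j. \<bar>s j\<bar> + deg G j + 1))"
  have C: "\<bar>s j\<bar> + deg G j + 1 \<le> C" for j by (simp add: C_def)
  have deg0: "0 \<le> deg G j" for j by (simp add: deg_def)
  have C0: "0 \<le> C" using C[of z] deg0[of z] by simp
  define P where "P v \<longleftrightarrow> v z = 0 \<and> (\<forall>j. j \<noteq> z \<longrightarrow> s j + laplacian G v j \<le> deg G j - 1)" for v
  \<comment> \<open>The minimum principle: \<open>v + C * h\<close> has negative Laplacian off \<open>z\<close>, so its minimum is at \<open>z\<close>.\<close>
  have bound: "0 \<le> v j + C * h j" if "P v" for v j
  proof -
    define w where "w j = v j + C * h j" for j
    have neg: "laplacian G w i < 0" if "i \<noteq> z" for i
    proof -
      have "C * laplacian G h i \<le> - C" using h(2)[rule_format, OF that] C0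
        by (metis mult.right_neutral mult_left_mono mult_minus_right)
      moreover have "s i + laplacian G v i \<le> deg G i - 1" using \<open>P v\<close> that by (simp add: P_def)
      moreover have "laplacian G w i = laplacian G v i + C * laplacian G h i"
        unfolding w_def by (simp add: laplacian_add laplacian_mult)
      ultimately show ?thesis using C[of i] by linarith
    qed
    have "Min (range w) \<in> range w" by (rule Min_in) auto
    then obtain i where i: "w i = Min (range w)" by (metis rangeE)
    then have "0 \<le> laplacian G w i" by (intro laplacian_at_min) simp
    with neg have "i = z" by (metis not_le)
    with i have "w z \<le> w j" by simp
    then show ?thesis using h(1) \<open>P v\<close> by (simp add: w_def P_def)
  qed
  have "P (\<lambda>j. C * h j)"
  proof -
    have "s j + C * laplacian G h j \<le> deg G j - 1" if "j \<noteq> z" for j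
    proof -
      have "C * laplacian G h j \<le> - C" using h(2)[rule_format, OF that] C0
        by (metis mult.right_neutral mult_left_mono mult_minus_right)
      then show ?thesis using C[of j] deg0[of j] by linarith
    qed
    then show ?thesis by (simp add: P_def h laplacian_mult)
  qed
  then obtain v where v: "P v"
    and least: "\<And>w. P w \<Longrightarrow> nat (mass (\<lambda>j. v j + C * h j)) \<le> nat (mass (\<lambda>j. w j + C * h j))"
    using ex_has_least_nat[of P "\<lambda>j. C * h j" "\<lambda>v. nat (mass (\<lambda>j. v j + C * h j))"] by blast
  have least': "mass v \<le> mass w" if "P w" for w
  proof -
    have "0 \<le> mass (\<lambda>j. v j + C * h j)" "0 \<le> mass (\<lambda>j. w j + C * h j)"
      using bound[OF v] bound[OF that] by (auto simp: mass_def intro!: sum_nonneg)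
    with least[OF that] show ?thesis by (simp add: mass_add)
  qed
  define \<sigma> where "\<sigma> j = s j + laplacian G v j" for j
  define \<rho> where "\<rho> = \<sigma>(z := deg G z)"
  have "no_forbidden_set G z \<rho>"
    unfolding no_forbidden_set_def
  proof (intro allI impI, rule ccontr)
    fix A :: "'v set" assume A: "A \<noteq> {}" "z \<notin> A" and "\<not> (\<exists>i\<in>A. inner_degree G A i \<le> \<rho> i)"
    then have forb: "\<sigma> i < inner_degree G A i" if "i \<in> A" for i
      using that by (metis \<rho>_def fun_upd_other not_le)
    define w where "w j = v j + ((if j \<in> A then 0 else 1) - 1)" for j
    have lap: "laplacian G w j = laplacian G v j + laplacian G (\<lambda>k. if k \<in> A then 0 else 1) j" for j
      unfolding w_def by (simp only: laplacian_add laplacian_diff laplacian_const)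
    have "s j + laplacian G w j \<le> deg G j - 1" if "j \<noteq> z" for j
    proof (cases "j \<in> A")
      case True
      then show ?thesis using forb[OF True] by (simp add: lap laplacian_indicator \<sigma>_def)
    next
      case False
      have "0 \<le> inner_degree G A j" by (simp add: inner_degree_def)
      moreover have "s j + laplacian G v j \<le> deg G j - 1" using v that by (simp add: P_def)
      ultimately show ?thesis using False by (simp add: lap laplacian_indicator)
    qed
    moreover have "w z = 0" using v A by (simp add: P_def w_def)
    ultimately have "P w" by (simp add: P_def)
    then have "mass v \<le> mass w" by (rule least')
    moreover obtain i where "i \<in> A" using A by auto
    then have "mass w < mass v"
      unfolding mass_def by (intro sum_strict_mono_ex1) (auto simp: w_def)
    ultimately show False by simp
  qed
  then have "recurrent G z \<rho>" using v by (auto simp: recurrent_iff \<rho>_def P_def \<sigma>_def)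
  moreover have "equivalent G s (\<lambda>j. \<rho> j + (\<sigma> z - deg G z) * delta z j)"
    unfolding equivalent_def
    by (intro exI[of _ v]) (auto simp: \<rho>_def \<sigma>_def delta_def)
  ultimately show thesis using that equivalent_sym by blast
qed

lemma recurrent_rep_eq:
  assumes "recurrent G z \<rho>" "equivalent G (\<lambda>j. \<rho> j + m * delta z j) s"
  shows "recurrent_rep G z s = \<rho>"
  unfolding recurrent_rep_def
proof (rule the_equality)
  obtain u where u: "s = (\<lambda>j. \<rho> j + m * delta z j + laplacian G u j)"
    using assms(2) by (auto simp: equivalent_def)
  then have "s = (\<lambda>j. \<rho> j + m * delta z j + laplacian G (\<lambda>k. u k - u z) j)"
    by (simp add: laplacian_diff laplacian_const)
  then show "\<rho> \<in> Rec G z \<and>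
      (\<exists>m v. v z = 0 \<and> s = (\<lambda>j. \<rho> j + m * delta z j + laplacian G v j))"
    using assms(1) by (auto simp: Rec_def intro!: exI[of _ m] exI[of _ "\<lambda>k. u k - u z"])
next
  fix \<rho>' assume "\<rho>' \<in> Rec G z \<and>
      (\<exists>m v. v z = 0 \<and> s = (\<lambda>j. \<rho>' j + m * delta z j + laplacian G v j))"
  then obtain m' where "recurrent G z \<rho>'" "equivalent G (\<lambda>j. \<rho>' j + m' * delta z j) s"
    by (auto simp: Rec_def equivalent_def)
  then show "\<rho>' = \<rho>"
    using assms recurrent_unique equivalent_sym equivalent_trans by metis
qed

lemma recurrent_nonneg:
  assumes "recurrent G z \<rho>" shows "0 \<le> \<rho> j"
proof (cases "j = z")
  case True
  then show ?thesis using assms by (simp add: recurrent_def deg_def)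
next
  case False
  then have "inner_degree G {j} j \<le> \<rho> j"
    using assms by (auto simp: recurrent_iff no_forbidden_set_def)
  then show ?thesis unfolding inner_degree_def by linarith
qed

lemma recurrent_le_deg: "recurrent G z \<rho> \<Longrightarrow> \<rho> j \<le> deg G j"
  by (cases "j = z") (auto simp: recurrent_def)

lemma finite_Rec: "finite (Rec G z)"
proof (rule finite_subset)
  show "Rec G z \<subseteq> (\<Pi>\<^sub>E j\<in>UNIV. {0..deg G j})"
    using recurrent_nonneg recurrent_le_deg by (auto simp: Rec_def)
  show "finite (\<Pi>\<^sub>E j\<in>(UNIV :: 'v set). {0..deg G j})" by (intro finite_PiE) auto
qed


section \<open>The threshold event of the closed chain\<close>

text \<open>This reduces the closed chain to a random walk: toppling does not change the equivalence class.\<close>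

lemma equivalent_closed_chain:
  "equivalent G (\<lambda>j. s j + chips x n j) (closed_chain G x s n)"
proof (induction n)
  case 0
  then show ?case by (simp add: chips_def equivalent_refl)
next
  case (Suc n)
  let ?t = "\<lambda>j. closed_chain G x s n j + delta (x (Suc n)) j"
  have "(\<lambda>j. s j + chips x (Suc n) j) = (\<lambda>j. (s j + chips x n j) + delta (x (Suc n)) j)"
    by (simp add: chips_def add.assoc)
  then have "equivalent G (\<lambda>j. s j + chips x (Suc n) j) ?t"
    using equivalent_add[OF Suc] by simp
  moreover have "equivalent G ?t (closed_chain G x s (Suc n))"
    by (simp add: add_chip_def Let_def equivalent_stabilization equivalent_refl)
  ultimately show ?case by (rule equivalent_trans)
qed

lemma stabilizable_closed_chain:
  "stabilizable G (closed_chain G x s n) \<longleftrightarrow> stabilizable G (\<lambda>j. s j + chips x n j)"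
  using equivalent_closed_chain equivalent_stabilizable equivalent_sym by metis

lemma stabilizable_mono:
  assumes "stabilizable G t" "\<And>j. s j \<le> t j"
  shows "stabilizable G s"
proof -
  obtain u where "\<And>j. t j + laplacian G u j \<le> deg G j - 1"
    using assms(1) by (auto simp: stabilizable_iff)
  then have "s j + laplacian G u j \<le> deg G j - 1" for j
    using assms(2)[of j] by (meson add_right_mono order_trans)
  then show ?thesis by (auto simp: stabilizable_iff)
qed

lemma stabilizable_mass_le:
  assumes "stabilizable G s" shows "mass s \<le> mass (deg G)"
proof -
  obtain u where u: "\<And>j. s j + laplacian G u j \<le> deg G j - 1"
    using assms by (auto simp: stabilizable_iff)
  have "s j + laplacian G u j \<le> deg G j" for j using u[of j] by simp
  then have "mass (\<lambda>j. s j + laplacian G u j) \<le> mass (deg G)"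
    unfolding mass_def by (intro sum_mono)
  then show ?thesis by (simp add: mass_add mass_laplacian)
qed

lemma recurrent_mass_nonneg: "recurrent G z \<rho> \<Longrightarrow> 0 \<le> mass \<rho>"
  unfolding mass_def by (intro sum_nonneg recurrent_nonneg)

lemma recurrent_mass_le: "recurrent G z \<rho> \<Longrightarrow> mass \<rho> \<le> mass (deg G)"
  unfolding mass_def by (intro sum_mono recurrent_le_deg)

text \<open>Recurrent sandpiles have nonnegative mass, so if the mass is negative, then so is the multiple of
  \<open>delta z\<close> that remains after the recurrent part is split off.\<close>

lemma negative_mass_stabilizable:
  assumes "mass s < 0" shows "stabilizable G s"
proof -
  fix z :: 'v
  obtain \<rho> m where \<rho>: "recurrent G z \<rho>" and eq: "equivalent G (\<lambda>j. \<rho> j + m * delta z j) s"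
    by (rule exists_recurrent)
  have "mass \<rho> + m = mass s" using equivalent_mass[OF eq] by (simp add: mass_add mass_delta)
  with recurrent_mass_nonneg[OF \<rho>] assms have "m < 0" by simp
  with \<rho> eq show ?thesis
    using equivalent_stabilizable[OF equivalent_sym[OF eq]] recurrent_stabilizable_iff by blast
qed

text \<open>Write the threshold state as \<open>\<rho> + m * delta i\<close> up to equivalence. It is not stabilizable, so
  \<open>m \<ge> 0\<close>; its predecessor is \<open>\<rho> + (m - 1) * delta i\<close> and stabilizable, so \<open>m \<le> 0\<close>. This uses that
  the last chip was added at the very vertex \<open>i\<close> that serves as the sink. The mass then
  determines the time.\<close>

lemma threshold_event_iff:
  assumes \<rho>: "recurrent G i \<rho>" and neg: "mass s < 0"
    and n: "int n = mass \<rho> - 1 - mass s"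
  shows "x (threshold_time G x s) = i \<and>
      recurrent_rep G i (closed_chain G x s (threshold_time G x s)) = \<rho> \<longleftrightarrow>
    x (Suc n) = i \<and> equivalent G (\<lambda>j. s j + chips x n j) (\<lambda>j. \<rho> j - delta i j)"
proof
  let ?\<tau> = "threshold_time G x s"
  assume ev: "x ?\<tau> = i \<and> recurrent_rep G i (closed_chain G x s ?\<tau>) = \<rho>"
  \<comment> \<open>The threshold is reached at all: the mass exceeds that of every stable sandpile eventually.\<close>
  let ?N = "nat (mass (deg G) + 1 - mass s)"
  have "0 \<le> mass (deg G)" by (simp add: mass_def deg_def sum_nonneg)
  then have "mass (deg G) < mass (\<lambda>j. s j + chips x ?N j)"
    using neg by (simp add: mass_add mass_chips)
  then have "\<not> stabilizable G (closed_chain G x s ?N)"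
    using stabilizable_mass_le[of "\<lambda>j. s j + chips x ?N j"]
    by (auto simp: stabilizable_closed_chain)
  then have unst: "\<not> stabilizable G (closed_chain G x s ?\<tau>)"
    unfolding threshold_time_def by (rule LeastI)
  moreover have "stabilizable G (closed_chain G x s 0)"
    using negative_mass_stabilizable[OF neg] by simp
  ultimately obtain k where k: "?\<tau> = Suc k" by (cases ?\<tau>) auto
  have st: "stabilizable G (closed_chain G x s k)"
    using not_less_Least[of k "\<lambda>k. \<not> stabilizable G (closed_chain G x s k)"] k
    by (simp add: threshold_time_def)
  obtain \<rho>' m where \<rho>': "recurrent G i \<rho>'"
    and eq: "equivalent G (\<lambda>j. \<rho>' j + m * delta i j) (closed_chain G x s ?\<tau>)"
    by (rule exists_recurrent)
  with ev have "\<rho>' = \<rho>" by (simp add: recurrent_rep_eq)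
  have xi: "x (Suc k) = i" using ev k by simp
  have eq': "equivalent G (\<lambda>j. \<rho> j + m * delta i j) (\<lambda>j. s j + chips x (Suc k) j)"
    using eq equivalent_closed_chain[of s x ?\<tau>] k \<open>\<rho>' = \<rho>\<close>
    by (metis equivalent_sym equivalent_trans)
  have pred: "equivalent G (\<lambda>j. \<rho> j + (m - 1) * delta i j) (\<lambda>j. s j + chips x k j)"
    using equivalent_add[OF eq', of "\<lambda>j. - delta i j"] xi
    by (simp add: chips_def algebra_simps)
  have "\<not> m < 0"
    using unst eq \<rho>' recurrent_stabilizable_iff equivalent_stabilizable equivalent_sym by blast
  moreover have "m - 1 < 0"
    using st pred \<rho> recurrent_stabilizable_iff equivalent_stabilizable stabilizable_closed_chain
    by blast
  ultimately have "m = 0" by simp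
  then have "mass \<rho> - 1 = mass s + int k"
    using equivalent_mass[OF pred] by (simp add: mass_add mass_diff mass_chips mass_delta1)
  with n have "k = n" by simp
  with pred xi \<open>m = 0\<close>
  show "x (Suc n) = i \<and> equivalent G (\<lambda>j. s j + chips x n j) (\<lambda>j. \<rho> j - delta i j)"
    by (auto intro: equivalent_sym)
next
  assume ev: "x (Suc n) = i \<and> equivalent G (\<lambda>j. s j + chips x n j) (\<lambda>j. \<rho> j - delta i j)"
  then have eqn: "equivalent G (\<lambda>j. s j + chips x n j) (\<lambda>j. \<rho> j + (- 1) * delta i j)" by simp
  then have "stabilizable G (\<lambda>j. s j + chips x n j)"
    using recurrent_stabilizable_iff[OF \<rho>, of "- 1"] equivalent_stabilizable by simp
  then have before: "stabilizable G (closed_chain G x s k)" if "k \<le> n" for k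
    unfolding stabilizable_closed_chain
    using chips_mono[OF that] by (elim stabilizable_mono) (simp add: add_left_mono)
  have "equivalent G (\<lambda>j. s j + chips x (Suc n) j) (\<lambda>j. \<rho> j + 0 * delta i j)"
    using equivalent_add[OF eqn, of "delta i"] ev by (simp add: chips_def add.assoc)
  then have at: "equivalent G (\<lambda>j. \<rho> j + 0 * delta i j) (closed_chain G x s (Suc n))"
    using equivalent_closed_chain[of s x "Suc n"] by (meson equivalent_sym equivalent_trans)
  then have "\<not> stabilizable G (closed_chain G x s (Suc n))"
    using recurrent_stabilizable_iff[OF \<rho>, of 0] equivalent_stabilizable by blast
  then have "threshold_time G x s = Suc n"
    unfolding threshold_time_def
    by (intro Least_equality) (use before not_less_eq_eq in blast)+
  with ev recurrent_rep_eq[OF \<rho> at] show "x (threshold_time G x s) = i \<and>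
      recurrent_rep G i (closed_chain G x s (threshold_time G x s)) = \<rho>"
    by simp
qed

section \<open>Equidistribution over the equivalence classes\<close>

text \<open>Write \<open>s - s'\<close> as \<open>\<rho> - mass \<rho> * delta z\<close> up to equivalence. Adding the chips of \<open>\<rho>\<close> to \<open>s'\<close> and as
  many at \<open>z\<close> to \<open>s\<close> makes the two equivalent. Since \<open>0 \<le> \<rho> \<le> deg G\<close>, further chips at \<open>z\<close> bring both
  numbers to \<open>mass (deg G)\<close>, independently of \<open>s\<close> and \<open>s'\<close>.\<close>

lemma couple_by_chips:
  assumes "mass s = mass s'"
  obtains c c' where "\<forall>j. 0 \<le> c j" "\<forall>j. 0 \<le> c' j" "mass c = mass (deg G)" "mass c' = mass (deg G)"
    "equivalent G (\<lambda>j. s j + c j) (\<lambda>j. s' j + c' j)"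
proof -
  fix z :: 'v
  obtain \<rho> m where \<rho>: "recurrent G z \<rho>"
    and eq: "equivalent G (\<lambda>j. \<rho> j + m * delta z j) (\<lambda>j. s j - s' j)"
    by (rule exists_recurrent)
  let ?N = "mass (deg G)"
  have m: "m = - mass \<rho>"
    using equivalent_mass[OF eq] assms by (simp add: mass_add mass_delta mass_diff)
  show thesis
  proof (rule that)
    show "\<forall>j. 0 \<le> ?N * delta z j"
      by (simp add: delta_def mass_def deg_def sum_nonneg)
    show "\<forall>j. 0 \<le> \<rho> j + (?N - mass \<rho>) * delta z j"
      using recurrent_nonneg[OF \<rho>] recurrent_mass_le[OF \<rho>] by (simp add: delta_def)
    show "equivalent G (\<lambda>j. s j + ?N * delta z j) (\<lambda>j. s' j + (\<rho> j + (?N - mass \<rho>) * delta z j))"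
      using equivalent_sym[OF equivalent_add[OF eq, of "\<lambda>j. s' j + ?N * delta z j"]]
      by (simp add: m algebra_simps)
    show "mass (\<lambda>j. ?N * delta z j) = ?N" by (rule mass_delta)
    show "mass (\<lambda>j. \<rho> j + (?N - mass \<rho>) * delta z j) = ?N"
      by (subst mass_add, subst mass_delta) simp
  qed
qed

text \<open>Exactly one of the translates is equivalent to \<open>t\<close>: the one by the recurrent sandpile that belongs
  to \<open>t - s\<close>.\<close>

lemma sum_Rec_equivalent:
  assumes "mass s = mass t"
  shows "(\<Sum>\<rho>\<in>Rec G z. of_bool (equivalent G (\<lambda>j. s j + (\<rho> j - mass \<rho> * delta z j)) t)) = (1 :: real)"
proof -
  obtain \<rho> m where \<rho>: "recurrent G z \<rho>"
    and eq: "equivalent G (\<lambda>j. \<rho> j + m * delta z j) (\<lambda>j. t j - s j)"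
    by (rule exists_recurrent)
  have m: "m = - mass \<rho>"
    using equivalent_mass[OF eq] assms by (simp add: mass_add mass_delta mass_diff)
  have "equivalent G (\<lambda>j. s j + (\<rho>' j - mass \<rho>' * delta z j)) t \<longleftrightarrow> \<rho>' = \<rho>"
    if "\<rho>' \<in> Rec G z" for \<rho>'
  proof
    assume "\<rho>' = \<rho>"
    then show "equivalent G (\<lambda>j. s j + (\<rho>' j - mass \<rho>' * delta z j)) t"
      using equivalent_add[OF eq, of s] by (simp add: m algebra_simps)
  next
    assume "equivalent G (\<lambda>j. s j + (\<rho>' j - mass \<rho>' * delta z j)) t"
    from equivalent_add[OF this, of "\<lambda>j. - s j"]
    have "equivalent G (\<lambda>j. \<rho>' j + (- mass \<rho>') * delta z j) (\<lambda>j. t j - s j)"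
      by (simp add: algebra_simps)
    then have "equivalent G (\<lambda>j. \<rho>' j + (- mass \<rho>') * delta z j) (\<lambda>j. \<rho> j + m * delta z j)"
      using eq equivalent_sym equivalent_trans by blast
    moreover have "recurrent G z \<rho>'" using that by (simp add: Rec_def)
    ultimately show "\<rho>' = \<rho>" using \<rho> recurrent_unique by blast
  qed
  then have "(\<Sum>\<rho>'\<in>Rec G z. of_bool (equivalent G (\<lambda>j. s j + (\<rho>' j - mass \<rho>' * delta z j)) t))
      = (\<Sum>\<rho>'\<in>Rec G z. if \<rho>' = \<rho> then 1 else (0 :: real))"
    by (intro sum.cong) auto
  also have "\<dots> = 1" using finite_Rec \<rho> by (simp add: Rec_def)
  finally show ?thesis .
qed

end


text \<open>The transition operator of the walk that adds a chip at a random vertex.\<close>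

definition average :: "'v pmf \<Rightarrow> (('v::finite \<Rightarrow> int) \<Rightarrow> real) \<Rightarrow> ('v \<Rightarrow> int) \<Rightarrow> real" where
  "average \<alpha> F s = (\<Sum>j\<in>UNIV. pmf \<alpha> j * F (\<lambda>k. s k + delta j k))"

lemma average_power_Suc:
  "(average \<alpha> ^^ Suc n) F s = (\<Sum>j\<in>UNIV. pmf \<alpha> j * (average \<alpha> ^^ n) F (\<lambda>k. s k + delta j k))"
  using average_def[of \<alpha> "(average \<alpha> ^^ n) F" s] by simp

lemma sum_pmf_finite: "(\<Sum>j\<in>UNIV. pmf (\<alpha> :: 'v::finite pmf) j) = 1"
  by (rule sum_pmf_eq_1) auto

text \<open>In a product-weighted average, one pair that lies below the bound \<open>\<epsilon>\<close> by \<open>\<delta>\<close> lowers the average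
  by at least its weight times \<open>\<delta>\<close>.\<close>

lemma weighted_pairs_le:
  fixes \<alpha> :: "'v::finite pmf" and D :: "'v \<Rightarrow> 'v \<Rightarrow> real"
  assumes \<beta>: "0 \<le> \<beta>" "\<And>j. \<beta> \<le> pmf \<alpha> j"
    and D: "\<And>j j'. D j j' \<le> \<epsilon>" and gap: "D a b \<le> \<epsilon> - \<delta>" "0 \<le> \<delta>"
  shows "(\<Sum>j\<in>UNIV. \<Sum>j'\<in>UNIV. pmf \<alpha> j * pmf \<alpha> j' * D j j') \<le> \<epsilon> - \<beta>\<^sup>2 * \<delta>"
proof -
  have "\<beta>\<^sup>2 * \<delta> \<le> (pmf \<alpha> a * pmf \<alpha> b) * (\<epsilon> - D a b)"
    unfolding power2_eq_square using \<beta> gap by (intro mult_mono) auto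
  also have "\<dots> \<le> (\<Sum>j'\<in>UNIV. pmf \<alpha> a * pmf \<alpha> j' * (\<epsilon> - D a j'))"
    using D by (intro member_le_sum[where f="\<lambda>j'. pmf \<alpha> a * pmf \<alpha> j' * (\<epsilon> - D a j')"]) auto
  also have "\<dots> \<le> (\<Sum>j\<in>UNIV. \<Sum>j'\<in>UNIV. pmf \<alpha> j * pmf \<alpha> j' * (\<epsilon> - D j j'))"
    using D by (intro member_le_sum[where f="\<lambda>j. \<Sum>j'\<in>UNIV. pmf \<alpha> j * pmf \<alpha> j' * (\<epsilon> - D j j')"]
        sum_nonneg mult_nonneg_nonneg) auto
  also have "\<dots> = (\<Sum>j\<in>UNIV. \<Sum>j'\<in>UNIV. pmf \<alpha> j * pmf \<alpha> j' * \<epsilon>)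
      - (\<Sum>j\<in>UNIV. \<Sum>j'\<in>UNIV. pmf \<alpha> j * pmf \<alpha> j' * D j j')"
    by (simp add: right_diff_distrib sum_subtractf)
  also have "(\<Sum>j\<in>UNIV. \<Sum>j'\<in>UNIV. pmf \<alpha> j * pmf \<alpha> j' * \<epsilon>) = \<epsilon>"
    by (simp add: sum_distrib_right[symmetric] sum_distrib_left[symmetric] sum_pmf_finite)
  finally show ?thesis by simp
qed

text \<open>The difference of two averages, written as the mean over two independent next chips.\<close>

lemma average_diff:
  "average \<alpha> F s - average \<alpha> F s' =
    (\<Sum>j\<in>UNIV. \<Sum>j'\<in>UNIV. pmf \<alpha> j * pmf \<alpha> j' *
      (F (\<lambda>k. s k + delta j k) - F (\<lambda>k. s' k + delta j' k)))"
proof -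
  have "(\<Sum>j\<in>UNIV. \<Sum>j'\<in>UNIV. pmf \<alpha> j * pmf \<alpha> j' * F (\<lambda>k. s k + delta j k)) = average \<alpha> F s"
    unfolding average_def
    by (simp add: sum_distrib_left[symmetric] sum_distrib_right[symmetric] sum_pmf_finite)
  moreover have "(\<Sum>j\<in>UNIV. \<Sum>j'\<in>UNIV. pmf \<alpha> j * pmf \<alpha> j' * F (\<lambda>k. s' k + delta j' k)) = average \<alpha> F s'"
    unfolding average_def
    by (subst sum.swap) (simp add: sum_distrib_left[symmetric] sum_distrib_right[symmetric] sum_pmf_finite)
  ultimately show ?thesis by (simp add: right_diff_distrib sum_subtractf)
qed

lemma mass_add_delta: "mass (\<lambda>k. s k + delta j k) = mass s + 1"
  by (simp add: mass_add mass_delta1)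

lemma average_power_oscillation:
  assumes "\<And>s s'. mass s = mass s' \<Longrightarrow> F s - F s' \<le> \<epsilon>" "mass s = mass s'"
  shows "(average \<alpha> ^^ n) F s - (average \<alpha> ^^ n) F s' \<le> \<epsilon>"
  using assms(2)
proof (induction n arbitrary: s s')
  case 0
  then show ?case using assms(1) by simp
next
  case (Suc n)
  show ?case
    using weighted_pairs_le[of 0 \<alpha> "\<lambda>j j'. (average \<alpha> ^^ n) F (\<lambda>k. s k + delta j k)
        - (average \<alpha> ^^ n) F (\<lambda>k. s' k + delta j' k)" \<epsilon> _ _ 0] Suc
    by (simp add: average_diff mass_add_delta)
qed

text \<open>Run two independent walks for \<open>n\<close> steps. With probability at least \<open>\<beta> ^ (2 * n)\<close> the first adds the
  chips of \<open>c\<close> and the second those of \<open>c'\<close>, in some fixed orders, and then \<open>F\<close> takes the same value; in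
  all other cases the values differ by at most \<open>\<epsilon>\<close>. The induction takes the first chip of each walk
  from \<open>c\<close> and \<open>c'\<close>.\<close>

lemma average_power_contract:
  assumes osc: "\<And>s s'. mass s = mass s' \<Longrightarrow> F s - F s' \<le> \<epsilon>" and "0 \<le> \<epsilon>"
    and \<beta>: "0 \<le> \<beta>" "\<And>j. \<beta> \<le> pmf \<alpha> j"
    and "mass s = mass s'" "\<And>j. 0 \<le> c j" "\<And>j. 0 \<le> c' j" "mass c = int n" "mass c' = int n"
    and "F (\<lambda>j. s j + c j) = F (\<lambda>j. s' j + c' j)"
  shows "(average \<alpha> ^^ n) F s - (average \<alpha> ^^ n) F s' \<le> \<epsilon> - \<beta> ^ (2 * n) * \<epsilon>"
  using assms(5-)
proof (induction n arbitrary: s s' c c')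
  case 0
  then have "c = (\<lambda>_. 0)" "c' = (\<lambda>_. 0)"
    by (auto simp: mass_def sum_nonneg_eq_0_iff)
  with 0 show ?case by simp
next
  case (Suc n)
  have pos: "\<exists>a. 1 \<le> d a" if "mass d = int (Suc n)" "\<And>j. 0 \<le> d j" for d :: "'a \<Rightarrow> int"
  proof (rule ccontr)
    assume "\<nexists>a. 1 \<le> d a"
    then have "d a \<le> 0" for a by (meson int_one_le_iff_zero_less not_le)
    then have "mass d \<le> 0" unfolding mass_def by (intro sum_nonpos)
    with that show False by simp
  qed
  from pos[of c] pos[of c'] Suc.prems obtain a b where ab: "1 \<le> c a" "1 \<le> c' b" by blast
  let ?G = "(average \<alpha> ^^ n) F"
  \<comment> \<open>The chips at \<open>a\<close> and \<open>b\<close> are the first ones taken from \<open>c\<close> and \<open>c'\<close>.\<close>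
  have "?G (\<lambda>k. s k + delta a k) - ?G (\<lambda>k. s' k + delta b k) \<le> \<epsilon> - \<beta> ^ (2 * n) * \<epsilon>"
  proof (rule Suc.IH)
    show "mass (\<lambda>k. s k + delta a k) = mass (\<lambda>k. s' k + delta b k)"
      using Suc.prems by (simp add: mass_add_delta)
    show "0 \<le> c j - delta a j" "0 \<le> c' j - delta b j" for j
      using Suc.prems(2,3)[of j] ab by (auto simp: delta_def)
    show "mass (\<lambda>j. c j - delta a j) = int n" "mass (\<lambda>j. c' j - delta b j) = int n"
      using Suc.prems by (simp_all add: mass_diff mass_delta1)
    show "F (\<lambda>j. s j + delta a j + (c j - delta a j)) = F (\<lambda>j. s' j + delta b j + (c' j - delta b j))"
      using Suc.prems by simp
  qed
  moreover have "?G (\<lambda>k. s k + delta j k) - ?G (\<lambda>k. s' k + delta j' k) \<le> \<epsilon>" for j j'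
    using osc Suc.prems by (intro average_power_oscillation) (auto simp: mass_add_delta)
  ultimately have "average \<alpha> ?G s - average \<alpha> ?G s' \<le> \<epsilon> - \<beta>\<^sup>2 * (\<beta> ^ (2 * n) * \<epsilon>)"
    unfolding average_diff using \<beta> \<open>0 \<le> \<epsilon>\<close>
    by (intro weighted_pairs_le[where a=a and b=b]) auto
  then show ?case by (simp add: power2_eq_square mult.assoc)
qed

context eulerian_sandpile
begin

text \<open>The probability that the \<open>n\<close>-step walk from a given sandpile ends in the class of \<open>t\<close>
  (see \<open>prob_chips\<close>).\<close>

definition hit :: "'v pmf \<Rightarrow> ('v \<Rightarrow> int) \<Rightarrow> nat \<Rightarrow> ('v \<Rightarrow> int) \<Rightarrow> real" where
  "hit \<alpha> t n = (average \<alpha> ^^ n) (\<lambda>s. of_bool (equivalent G s t))"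

lemma equivalent_cong: "equivalent G s s' \<Longrightarrow> equivalent G s t \<longleftrightarrow> equivalent G s' t"
  using equivalent_sym equivalent_trans by blast

lemma hit_cong: "equivalent G s s' \<Longrightarrow> hit \<alpha> t n s = hit \<alpha> t n s'"
proof (induction n arbitrary: s s')
  case 0
  then show ?case by (simp add: hit_def equivalent_cong)
next
  case (Suc n)
  show ?case
    using Suc.IH[OF equivalent_add[OF Suc.prems]]
    by (simp add: hit_def average_def)
qed

text \<open>After any number of steps exactly one of the translated walks is in the class of \<open>t\<close>, so the
  expected number of those that are is one.\<close>

lemma sum_Rec_hit:
  assumes "mass s + int n = mass t"
  shows "(\<Sum>\<rho>\<in>Rec G z. hit \<alpha> t n (\<lambda>j. s j + (\<rho> j - mass \<rho> * delta z j))) = 1"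
  using assms
proof (induction n arbitrary: s)
  case 0
  then show ?case using sum_Rec_equivalent[of s t z] by (simp add: hit_def)
next
  case (Suc n)
  have "(\<Sum>\<rho>\<in>Rec G z. hit \<alpha> t (Suc n) (\<lambda>j. s j + (\<rho> j - mass \<rho> * delta z j))) =
    (\<Sum>\<rho>\<in>Rec G z. \<Sum>i\<in>UNIV. pmf \<alpha> i *
      hit \<alpha> t n (\<lambda>j. (s j + delta i j) + (\<rho> j - mass \<rho> * delta z j)))"
    unfolding hit_def by (simp add: average_def ac_simps)
  also have "\<dots> = (\<Sum>i\<in>UNIV. pmf \<alpha> i * (\<Sum>\<rho>\<in>Rec G z.
      hit \<alpha> t n (\<lambda>j. (s j + delta i j) + (\<rho> j - mass \<rho> * delta z j))))"
    by (subst sum.swap) (simp add: sum_distrib_left)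
  also have "\<dots> = (\<Sum>i\<in>UNIV. pmf \<alpha> i * 1)"
    using Suc.prems by (intro sum.cong refl arg_cong2[of _ _ _ _ "(*)"] Suc.IH) (simp add: mass_add_delta)
  also have "\<dots> = 1" by (simp add: sum_pmf_finite)
  finally show ?case .
qed

text \<open>Each block of \<open>mass (deg G)\<close> steps gives two walks that start with equal mass a fresh chance to
  merge.\<close>

lemma hit_oscillation:
  assumes \<beta>: "0 \<le> \<beta>" "\<And>j. \<beta> \<le> pmf \<alpha> j"
    and "k * nat (mass (deg G)) \<le> n" "mass s = mass s'"
  shows "hit \<alpha> t n s - hit \<alpha> t n s' \<le> (1 - \<beta> ^ (2 * nat (mass (deg G)))) ^ k"
  using assms(3,4)
proof (induction k arbitrary: n s s')
  case 0
  show ?case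
    unfolding hit_def using 0 by (simp, intro average_power_oscillation) auto
next
  case (Suc k)
  let ?N = "nat (mass (deg G))"
  define m where "m = n - ?N"
  have n: "n = ?N + m" and m: "k * ?N \<le> m" using Suc.prems(1) by (auto simp: m_def)
  have split: "hit \<alpha> t n = (average \<alpha> ^^ ?N) (hit \<alpha> t m)"
    by (simp add: hit_def n funpow_add)
  have "\<beta> \<le> 1" by (rule order_trans[OF \<beta>(2) pmf_le_1])
  then have "\<beta> ^ (2 * ?N) \<le> 1" using \<beta>(1) by (simp add: power_le_one)
  then have \<epsilon>0: "0 \<le> (1 - \<beta> ^ (2 * ?N)) ^ k" by simp
  obtain c c' where c: "\<forall>j. 0 \<le> c j" "\<forall>j. 0 \<le> c' j" "mass c = mass (deg G)" "mass c' = mass (deg G)"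
    "equivalent G (\<lambda>j. s j + c j) (\<lambda>j. s' j + c' j)"
    using Suc.prems(2) by (rule couple_by_chips)
  have "0 \<le> mass (deg G)" by (simp add: mass_def deg_def sum_nonneg)
  then have "hit \<alpha> t n s - hit \<alpha> t n s'
      \<le> (1 - \<beta> ^ (2 * ?N)) ^ k - \<beta> ^ (2 * ?N) * (1 - \<beta> ^ (2 * ?N)) ^ k"
    unfolding split using Suc.prems(2) c \<beta> \<epsilon>0 Suc.IH[OF m] hit_cong[OF c(5)]
    by (intro average_power_contract[where c=c and c'=c']) auto
  then show ?case by (simp add: algebra_simps)
qed

text \<open>Probabilities that sum to one over \<open>card (Rec G z)\<close> starting points and are all close to each other
  are close to \<open>1 / card (Rec G z)\<close>.\<close>

lemma hit_limit:
  assumes \<beta>: "0 \<le> \<beta>" "\<And>j. \<beta> \<le> pmf \<alpha> j"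
    and n: "k * nat (mass (deg G)) \<le> n" and mass: "mass s + int n = mass t"
  shows "\<bar>hit \<alpha> t n s - 1 / card (Rec G z)\<bar> \<le> (1 - \<beta> ^ (2 * nat (mass (deg G)))) ^ k"
proof -
  let ?\<epsilon> = "(1 - \<beta> ^ (2 * nat (mass (deg G)))) ^ k" and ?\<kappa> = "real (card (Rec G z))"
  let ?h = "\<lambda>\<rho>. hit \<alpha> t n (\<lambda>j. s j + (\<rho> j - mass \<rho> * delta z j))"
  obtain \<rho> m where "recurrent G z \<rho>" "equivalent G (\<lambda>j. \<rho> j + m * delta z j) s"
    by (rule exists_recurrent)
  then have \<kappa>: "0 < ?\<kappa>" using finite_Rec by (auto simp: Rec_def card_gt_0_iff)
  have same: "mass (\<lambda>j. s j + (\<rho> j - mass \<rho> * delta z j)) = mass s" for \<rho>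
    by (simp add: mass_add mass_diff mass_delta)
  have close: "\<bar>hit \<alpha> t n s - ?h \<rho>\<bar> \<le> ?\<epsilon>" for \<rho>
    using hit_oscillation[OF \<beta> n] same by (simp add: abs_le_iff)
  have "?\<kappa> * hit \<alpha> t n s - 1 = (\<Sum>\<rho>\<in>Rec G z. hit \<alpha> t n s - ?h \<rho>)"
    using sum_Rec_hit[OF mass] by (simp add: sum_subtractf)
  then have "\<bar>?\<kappa> * hit \<alpha> t n s - 1\<bar> \<le> (\<Sum>\<rho>\<in>Rec G z. \<bar>hit \<alpha> t n s - ?h \<rho>\<bar>)"
    by simp
  also have "\<dots> \<le> (\<Sum>\<rho>\<in>Rec G z. ?\<epsilon>)" by (intro sum_mono close)
  finally have "\<bar>?\<kappa> * hit \<alpha> t n s - 1\<bar> \<le> ?\<kappa> * ?\<epsilon>" by simp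
  moreover have "?\<kappa> * hit \<alpha> t n s - 1 = ?\<kappa> * (hit \<alpha> t n s - 1 / ?\<kappa>)"
    using \<kappa> by (simp add: right_diff_distrib)
  ultimately show ?thesis using \<kappa> by (simp add: abs_mult)
qed

end

section \<open>The independent driving sequence\<close>

context prob_space
begin

lemma independent_next_vertex:
  fixes I :: "nat \<Rightarrow> 'a \<Rightarrow> 'v::finite"
  assumes "indep_vars (\<lambda>_. count_space UNIV) I {1..}"
  shows "{\<omega> \<in> space M. Q (chips (\<lambda>k. I k \<omega>) n)} \<in> events" (is ?A)
    and "prob {\<omega> \<in> space M. I (Suc n) \<omega> = j \<and> Q (chips (\<lambda>k. I k \<omega>) n)} =
      prob {\<omega> \<in> space M. I (Suc n) \<omega> = j} * prob {\<omega> \<in> space M. Q (chips (\<lambda>k. I k \<omega>) n)}" (is ?B)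
proof -
  let ?C = "count_space UNIV :: 'v measure"
  have "indep_var (PiM {Suc n} (\<lambda>_. ?C)) (\<lambda>\<omega>. restrict (\<lambda>k. I k \<omega>) {Suc n})
      (PiM {1..n} (\<lambda>_. ?C)) (\<lambda>\<omega>. restrict (\<lambda>k. I k \<omega>) {1..n})"
    using assms by (rule indep_var_restrict) auto
  then have "indep_var (count_space UNIV)
        ((\<lambda>f. f (Suc n) = j) \<circ> (\<lambda>\<omega>. restrict (\<lambda>k. I k \<omega>) {Suc n}))
      (count_space UNIV) ((\<lambda>f. Q (chips f n)) \<circ> (\<lambda>\<omega>. restrict (\<lambda>k. I k \<omega>) {1..n}))"
    \<comment> \<open>A finite product of discrete spaces is discrete, so all functions on it are measurable.\<close>
    by (rule indep_var_compose) (auto simp: count_space_PiM_finite)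
  moreover have "chips (restrict (\<lambda>k. I k \<omega>) {1..n}) n = chips (\<lambda>k. I k \<omega>) n" for \<omega>
    by (auto simp: chips_def fun_eq_iff intro!: sum.cong)
  ultimately have ind: "indep_var (count_space UNIV) (\<lambda>\<omega>. I (Suc n) \<omega> = j)
      (count_space UNIV) (\<lambda>\<omega>. Q (chips (\<lambda>k. I k \<omega>) n))"
    by (simp add: comp_def)
  from measurable_sets[OF indep_var_rv2[OF ind], of "{True}"] show ?A
    by (simp add: vimage_def Int_def conj_commute)
  from indep_varD[OF ind, of "{True}" "{True}"] show ?B
    by (simp add: vimage_def Int_def conj_commute)
qed

text \<open>The last vertex is split off on the probability side and moved into the starting point, which is
  the recursion of \<open>average\<close>; the chips may be reordered since only their sum matters.\<close>

lemma prob_chips: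
  fixes I :: "nat \<Rightarrow> 'a \<Rightarrow> 'v::finite"
  assumes ind: "indep_vars (\<lambda>_. count_space UNIV) I {1..}"
    and law: "\<And>k j. 1 \<le> k \<Longrightarrow> prob {\<omega> \<in> space M. I k \<omega> = j} = pmf \<alpha> j"
  shows "prob {\<omega> \<in> space M. Q (\<lambda>j. s j + chips (\<lambda>k. I k \<omega>) n j)} =
    (average \<alpha> ^^ n) (\<lambda>s. of_bool (Q s)) s"
proof (induction n arbitrary: s)
  case 0
  then show ?case by (cases "Q s") (simp_all add: chips_def prob_space)
next
  case (Suc n)
  let ?Q = "\<lambda>j c. Q (\<lambda>i. (s i + delta j i) + c i)"
  let ?E = "\<lambda>j. {\<omega> \<in> space M. I (Suc n) \<omega> = j \<and> ?Q j (chips (\<lambda>k. I k \<omega>) n)}"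
  have meas: "?E j \<in> events" for j
  proof -
    have "I (Suc n) \<in> measurable M (count_space UNIV)"
      using ind by (auto simp: indep_vars_def)
    from measurable_sets[OF this, of "{j}"] have "{\<omega> \<in> space M. I (Suc n) \<omega> = j} \<in> events"
      by (simp add: vimage_def Int_def conj_commute)
    then have "{\<omega> \<in> space M. I (Suc n) \<omega> = j} \<inter> {\<omega> \<in> space M. ?Q j (chips (\<lambda>k. I k \<omega>) n)} \<in> events"
      using independent_next_vertex(1)[OF ind, of "?Q j" n] by (rule sets.Int)
    then show ?thesis by (simp add: Int_def conj_ac)
  qed
  have "{\<omega> \<in> space M. Q (\<lambda>j. s j + chips (\<lambda>k. I k \<omega>) (Suc n) j)} = (\<Union>j\<in>UNIV. ?E j)"
    by (auto simp: chips_def ac_simps)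
  then have "prob {\<omega> \<in> space M. Q (\<lambda>j. s j + chips (\<lambda>k. I k \<omega>) (Suc n) j)} = (\<Sum>j\<in>UNIV. prob (?E j))"
    using meas by (simp, intro finite_measure_finite_Union) (auto simp: disjoint_family_on_def)
  also have "\<dots> = (\<Sum>j\<in>UNIV. pmf \<alpha> j * (average \<alpha> ^^ n) (\<lambda>s. of_bool (Q s)) (\<lambda>i. s i + delta j i))"
  proof (rule sum.cong)
    fix j
    show "prob (?E j) = pmf \<alpha> j * (average \<alpha> ^^ n) (\<lambda>s. of_bool (Q s)) (\<lambda>i. s i + delta j i)"
      using independent_next_vertex(2)[OF ind, of n j "?Q j"] Suc[of "\<lambda>i. s i + delta j i"] by (simp add: law)
  qed simp
  finally show ?case by (simp only: average_power_Suc)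
qed

end

section \<open>The limit law at the threshold\<close>

theorem corollary3:
  fixes G :: "('v::finite, 'e) pre_digraph"
    and \<alpha> :: "'v pmf"
    and M :: "'w measure"
    and I :: "nat \<Rightarrow> 'w \<Rightarrow> 'v"
    and i z :: 'v
    and \<rho> :: "'v \<Rightarrow> int"
  assumes "fin_digraph G" and "verts G = UNIV"
    and "Digraph_Component.connected G"
    and "\<forall>v. in_degree G v = out_degree G v"
    and "\<forall>j. pmf \<alpha> j > 0"
    and "prob_space M"
    and "prob_space.indep_vars M (\<lambda>_. count_space UNIV) I {1..}"
    and "\<forall>k\<ge>1. distr M (count_space UNIV) (I k) = measure_pmf \<alpha>"
    and "\<rho> \<in> Rec G i"
  shows "\<forall>\<epsilon>>0. \<exists>K<0. \<forall>s0. mass s0 < K \<longrightarrow>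
    \<bar>measure M {\<omega> \<in> space M.
        let x = (\<lambda>k. I k \<omega>); \<tau> = threshold_time G x s0 in
        x \<tau> = i \<and> recurrent_rep G i (closed_chain G x s0 \<tau>) = \<rho>}
      - pmf \<alpha> i / real (card (Rec G z))\<bar> \<le> \<epsilon>"
proof (intro allI impI)
  fix \<epsilon> :: real assume "0 < \<epsilon>"
  interpret eulerian_sandpile G
    using assms(1-4) by (simp add: eulerian_sandpile_def eulerian_sandpile_axioms_def)
  interpret prob_space M by (rule assms(6))
  have \<rho>: "recurrent G i \<rho>" using assms(9) by (simp add: Rec_def)
  have law: "prob {\<omega> \<in> space M. I k \<omega> = j} = pmf \<alpha> j" if "1 \<le> k" for k j
  proof -
    have "I k \<in> measurable M (count_space UNIV)"
      using assms(7) that by (auto simp: indep_vars_def)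
    then have "measure (distr M (count_space UNIV) (I k)) {j} = prob (I k -` {j} \<inter> space M)"
      by (rule measure_distr) simp
    then show ?thesis
      using assms(8) that by (simp add: vimage_def Int_def conj_commute measure_pmf_single)
  qed
  define \<beta> where "\<beta> = Min (range (pmf \<alpha>))"
  have \<beta>: "0 < \<beta>" "\<And>j. \<beta> \<le> pmf \<alpha> j" using assms(5) by (simp_all add: \<beta>_def)
  define N where "N = nat (mass (deg G))"
  have "0 < \<beta> ^ (2 * N)" using \<beta>(1) by simp
  then obtain k where k: "(1 - \<beta> ^ (2 * N)) ^ k < \<epsilon>"
    using real_arch_pow_inv[OF \<open>0 < \<epsilon>\<close>, of "1 - \<beta> ^ (2 * N)"] by auto
  define t where "t = (\<lambda>j. \<rho> j - delta i j)"
  have mass_t: "mass t = mass \<rho> - 1"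
    by (simp add: t_def mass_diff mass_delta1)
  let ?E = "\<lambda>s0. {\<omega> \<in> space M.
      let x = (\<lambda>k. I k \<omega>); \<tau> = threshold_time G x s0 in
      x \<tau> = i \<and> recurrent_rep G i (closed_chain G x s0 \<tau>) = \<rho>}"
  \<comment> \<open>Mass below this bound makes \<open>s0\<close> stabilizable and leaves at least \<open>k\<close> blocks of \<open>N\<close> steps.\<close>
  let ?K = "- 1 - int (k * N)"
  have "\<bar>prob (?E s0) - pmf \<alpha> i / real (card (Rec G z))\<bar> \<le> \<epsilon>" if K: "mass s0 < ?K" for s0
  proof -
    define n where "n = nat (mass \<rho> - 1 - mass s0)"
    have le: "int (k * N) \<le> mass \<rho> - 1 - mass s0"
      using K recurrent_mass_nonneg[OF \<rho>] by linarith
    then have n: "int n = mass \<rho> - 1 - mass s0"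
      unfolding n_def using of_nat_0_le_iff[of "k * N"] by (metis int_nat_eq order_trans)
    with le have kn: "k * N \<le> n" by linarith
    have "mass s0 < 0" using K of_nat_0_le_iff[of "k * N"] by linarith
    then have "prob (?E s0) =
      prob {\<omega> \<in> space M. I (Suc n) \<omega> = i \<and> equivalent G (\<lambda>j. s0 j + chips (\<lambda>k. I k \<omega>) n j) t}"
      by (simp add: Let_def threshold_event_iff[OF \<rho> _ n] t_def)
    also have "\<dots> = pmf \<alpha> i * hit \<alpha> t n s0"
      using independent_next_vertex(2)[OF assms(7), of n i "\<lambda>c. equivalent G (\<lambda>j. s0 j + c j) t"]
        prob_chips[OF assms(7) law, of "\<lambda>s. equivalent G s t" s0 n]
      by (simp add: law hit_def)
    finally have "\<bar>prob (?E s0) - pmf \<alpha> i / real (card (Rec G z))\<bar> = \<bar>pmf \<alpha> i * (hit \<alpha> t n s0 - 1 / card (Rec G z))\<bar>"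
      by (simp add: right_diff_distrib)
    also have "\<dots> = pmf \<alpha> i * \<bar>hit \<alpha> t n s0 - 1 / card (Rec G z)\<bar>"
      by (simp add: abs_mult)
    also have "\<dots> \<le> 1 * (1 - \<beta> ^ (2 * N)) ^ k"
      using hit_limit[of \<beta> \<alpha> k n s0 t z] \<beta> kn mass_t n
      by (intro mult_mono) (auto simp: pmf_le_1 N_def)
    finally show ?thesis using k by simp
  qed
  then show "\<exists>K<0. \<forall>s0. mass s0 < K \<longrightarrow>
    \<bar>prob (?E s0) - pmf \<alpha> i / real (card (Rec G z))\<bar> \<le> \<epsilon>"
    by (intro exI[of _ ?K]) (use of_nat_0_le_iff[of "k * N"] in \<open>simp del: of_nat_mult\<close>)
qed

end
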